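(* Consider the discretization, defined in the context, of the double integral $$\mathcal J=\lambda\int_0^\infty\!\!\int_0^\infty f(y_1,y_2)\,v(s_1y_1,s_2y_2,t)\,\mathrm{d}y_1\,\mathrm{d}y_2$$ of the two-dimensional Kou partial integro-differential equation on the $(m_1+1)\times(m_2+1)$ spatial grid. It is evaluated through double cumulative sums, and the coefficients $\gamma^{ab}_{\nu,kl}$ and the values $\psi_\nu(s_{1,i},s_{2,j})$, which are independent of $t$, are computed upfront. Then the number of basic arithmetic operations to compute, for any given $t$ (that is, for any given vector of values $V_{i,j}(t)$), the approximation to the double integral $\mathcal J$ on the full spatial grid is, to leading order, equal to $40\,m_1m_2$. Here the computation of all $J_{1,ij}$ $(1\le i\le m_1,\ 1\le j\le m_2)$ takes, to leading order, $10\,m_1m_2$ operations: $3m_1m_2$ additions and $4m_1m_2$ multiplications for all $G_{1,kl}$, $2m_1m_2$ additions for all double cumulative sums, and the multiplications by the precomputed values of $\psi_1$. The evaluation of $J_{2,ij}$, $J_{3,ij}$, $J_{4,ij}$ is done completely analogously. In particular, the computational cost is directly proportional to the number of spatial grid points, which is optimal.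
   Context: Kou model: $\lambda$ is the jump intensity. For $i=1,2$ the parameters $p_i,q_i,\eta_{p_i},\eta_{q_i}$ are positive constants with $p_i+q_i=1$ and $\eta_{p_i}>1$. The joint density of the relative jump sizes is $f(y_1,y_2)=f_1(y_1)f_2(y_2)$ with $f_i(y)=q_i\eta_{q_i}y^{\eta_{q_i}-1}$ for $0<y<1$ and $f_i(y)=p_i\eta_{p_i}y^{-\eta_{p_i}-1}$ for $y\ge 1$. The function $v(s_1,s_2,t)$ is the value of a European two-asset option, with strike $K>0$. Grid: the spatial domain is truncated to $[0,S_{\max}]^2$ with $S_{\max}$ sufficiently large. The grid points are $(s_{1,i},s_{2,j})$, $0\le i\le m_1$, $0\le j\le m_2$. In each direction the mesh $0=s_0<s_1<\dots<s_m=S_{\max}$ is given by $s_i=\varphi(\xi_i)$ with equidistant points $0=\xi_0<\dots<\xi_m=\xi_{\max}$, where $\xi_{\rm int}=2K/d$, $\xi_{\max}=\xi_{\rm int}+\sinh^{-1}(S_{\max}/d-\xi_{\rm int})$, $d=K/10$, $\varphi(\xi)=d\,\xi$ for $0\le\xi\le\xi_{\rm int}$ and $\varphi(\xi)=2K+d\sinh(\xi-\xi_{\rm int})$ for $\xi_{\rm int}<\xi\le\xi_{\max}$. $V_{i,j}(t)$ denotes the semidiscrete approximation to $v(s_{1,i},s_{2,j},t)$. Discretization: $\mathcal J$ is split into four integrals $\mathcal J_1,\dots,\mathcal J_4$ according to the four pieces of $f$ (respectively $y_1,y_2<1$; $y_1\ge1,y_2<1$; $y_1<1,y_2\ge1$;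 $y_1,y_2\ge1$). On each grid cell $v$ is replaced by its bilinear interpolant, and $v$ is approximated by zero outside $[0,S_{\max}]^2$. Let $$\psi_1=\lambda q_1q_2\eta_{q_1}\eta_{q_2}s_1^{-\eta_{q_1}}s_2^{-\eta_{q_2}},\quad \psi_2=\lambda p_1q_2\eta_{p_1}\eta_{q_2}s_1^{\eta_{p_1}}s_2^{-\eta_{q_2}},$$ $$\psi_3=\lambda q_1p_2\eta_{q_1}\eta_{p_2}s_1^{-\eta_{q_1}}s_2^{\eta_{p_2}},\quad \psi_4=\lambda p_1p_2\eta_{p_1}\eta_{p_2}s_1^{\eta_{p_1}}s_2^{\eta_{p_2}}$$ as functions of $(s_1,s_2)$. For $1\le i\le m_1$, $1\le j\le m_2$ the approximations of $\mathcal J_1,\dots,\mathcal J_4$ at $(s_{1,i},s_{2,j})$ are $$J_{1,ij}=\psi_1(s_{1,i},s_{2,j})\sum_{k=1}^{i}\sum_{l=1}^{j}G_{1,kl},\qquad J_{2,ij}=\psi_2(s_{1,i},s_{2,j})\sum_{k=i+1}^{m_1}\sum_{l=1}^{j}G_{2,kl},$$ $$J_{3,ij}=\psi_3(s_{1,i},s_{2,j})\sum_{k=1}^{i}\sum_{l=j+1}^{m_2}G_{3,kl},\qquad J_{4,ij}=\psi_4(s_{1,i},s_{2,j})\sum_{k=i+1}^{m_1}\sum_{l=j+1}^{m_2}G_{4,kl}$$ (empty sums are zero), and $\mathcal J$ is approximated by $J_{1,ij}+J_{2,ij}+J_{3,ij}+J_{4,ij}$. For the indices $k,l$ occurring in these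 sums, $$G_{\nu,kl}=\gamma^{00}_{\nu,kl}V_{k-1,l-1}(t)+\gamma^{10}_{\nu,kl}V_{k,l-1}(t)+\gamma^{01}_{\nu,kl}V_{k-1,l}(t)+\gamma^{11}_{\nu,kl}V_{k,l}(t),$$ where, with $\delta_{kl}=(s_{1,k}-s_{1,k-1})(s_{2,l}-s_{2,l-1})$ and writing $\zeta^{ab}$ for $\zeta^{ab}_{\nu,kl}$, $$\gamma^{00}_{\nu,kl}=(s_{1,k}s_{2,l}\zeta^{00}-s_{2,l}\zeta^{10}-s_{1,k}\zeta^{01}+\zeta^{11})/\delta_{kl},$$ $$\gamma^{10}_{\nu,kl}=(-s_{1,k-1}s_{2,l}\zeta^{00}+s_{2,l}\zeta^{10}+s_{1,k-1}\zeta^{01}-\zeta^{11})/\delta_{kl},$$ $$\gamma^{01}_{\nu,kl}=(-s_{1,k}s_{2,l-1}\zeta^{00}+s_{2,l-1}\zeta^{10}+s_{1,k}\zeta^{01}-\zeta^{11})/\delta_{kl},$$ $$\gamma^{11}_{\nu,kl}=(s_{1,k-1}s_{2,l-1}\zeta^{00}-s_{2,l-1}\zeta^{10}-s_{1,k-1}\zeta^{01}+\zeta^{11})/\delta_{kl},$$ $$\zeta^{ab}_{\nu,kl}=\frac{(s_{1,k}^{a+\alpha_\nu}-s_{1,k-1}^{a+\alpha_\nu})(s_{2,l}^{b+\beta_\nu}-s_{2,l-1}^{b+\beta_\nu})}{(a+\alpha_\nu)(b+\beta_\nu)}\qquad(a,b\in\{0,1\}),$$ with $(\alpha_1,\beta_1)=(\eta_{q_1},\eta_{q_2})$,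 $(\alpha_2,\beta_2)=(-\eta_{p_1},\eta_{q_2})$, $(\alpha_3,\beta_3)=(\eta_{q_1},-\eta_{p_2})$, $(\alpha_4,\beta_4)=(-\eta_{p_1},-\eta_{p_2})$. Boundary: on $s_2=0$, $s_1>0$ the double integral reduces to $\lambda\int_0^\infty f_1(y_1)v(s_1y_1,0,t)\,\mathrm{d}y_1$. At $(s_{1,i},0)$, $1\le i\le m_1$, it is approximated by $$\lambda q_1\eta_{q_1}s_{1,i}^{-\eta_{q_1}}\sum_{k=1}^{i}G_{1,k}+\lambda p_1\eta_{p_1}s_{1,i}^{\eta_{p_1}}\sum_{k=i+1}^{m_1}G_{2,k},$$ where, by linear interpolation, $G_{\nu,k}=\gamma^0_{\nu,k}V_{k-1,0}(t)+\gamma^1_{\nu,k}V_{k,0}(t)$ with $\gamma^0_{\nu,k}=(s_{1,k}\zeta^0_{\nu,k}-\zeta^1_{\nu,k})/(s_{1,k}-s_{1,k-1})$, $\gamma^1_{\nu,k}=(-s_{1,k-1}\zeta^0_{\nu,k}+\zeta^1_{\nu,k})/(s_{1,k}-s_{1,k-1})$ and $\zeta^a_{\nu,k}=(s_{1,k}^{a+\alpha_\nu}-s_{1,k-1}^{a+\alpha_\nu})/(a+\alpha_\nu)$ for $\nu=1,2$ and $a=0,1$. The boundary $s_1=0$, $s_2>0$ is treated in the same way with the roles of the two assets interchanged. At $(0,0)$ the approximation is $\lambda V_{0,0}(t)$.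
   Formalization: The count 40 m1 m2 is proved for computing all J_1,...,J_4 and the boundary values; forming the sum J_1+J_2+J_3+J_4 takes 3 m1 m2 further additions, so the approximation to the double integral itself costs 43 m1 m2 to leading order with the described algorithm. *)

theory Defs
  imports Complex_Main "HOL-Library.Landau_Symbols"
begin

section \<open>Model parameters and spatial grid\<close>

text \<open>The functions \<open>p, q, eta_p, eta_q\<close> are indexed by the asset, \<open>1\<close> or \<open>2\<close>.\<close>

record kou =
  lam :: real
  p :: "nat \<Rightarrow> real"
  q :: "nat \<Rightarrow> real"
  eta_p :: "nat \<Rightarrow> real"
  eta_q :: "nat \<Rightarrow> real"
  strike :: real
  Smax :: real

definition mesh_d :: "kou \<Rightarrow> real" where
  "mesh_d P = strike P / 10"

definition xi_int :: "kou \<Rightarrow> real" where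
  "xi_int P = 2 * strike P / mesh_d P"

definition xi_max :: "kou \<Rightarrow> real" where
  "xi_max P = xi_int P + arsinh (Smax P / mesh_d P - xi_int P)"

definition phi :: "kou \<Rightarrow> real \<Rightarrow> real" where
  "phi P x = (if x \<le> xi_int P then mesh_d P * x
              else 2 * strike P + mesh_d P * sinh (x - xi_int P))"

text \<open>\<open>mesh P m i\<close> is the \<open>i\<close>-th of the points \<open>0, \<dots>, m\<close> in a direction with \<open>m\<close> cells.\<close>

definition mesh :: "kou \<Rightarrow> nat \<Rightarrow> nat \<Rightarrow> real" where
  "mesh P m i = phi P (real i * xi_max P / real m)"


section \<open>Discretization of the double integral\<close>

datatype quadrant = Q1 | Q2 | Q3 | Q4

text \<open>\<open>far1\<close>, \<open>far2\<close> tell whether the quadrant has \<open>y\<^sub>1 \<ge> 1\<close>, respectively \<open>y\<^sub>2 \<ge> 1\<close>.\<close>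

fun far1 :: "quadrant \<Rightarrow> bool" where
  "far1 Q1 = False" | "far1 Q2 = True" | "far1 Q3 = False" | "far1 Q4 = True"

fun far2 :: "quadrant \<Rightarrow> bool" where
  "far2 Q1 = False" | "far2 Q2 = False" | "far2 Q3 = True" | "far2 Q4 = True"

fun alpha :: "kou \<Rightarrow> quadrant \<Rightarrow> real" where
  "alpha P Q1 = eta_q P 1" | "alpha P Q2 = - eta_p P 1"
| "alpha P Q3 = eta_q P 1" | "alpha P Q4 = - eta_p P 1"

fun beta :: "kou \<Rightarrow> quadrant \<Rightarrow> real" where
  "beta P Q1 = eta_q P 2" | "beta P Q2 = eta_q P 2"
| "beta P Q3 = - eta_p P 2" | "beta P Q4 = - eta_p P 2"

fun psi :: "kou \<Rightarrow> quadrant \<Rightarrow> real \<Rightarrow> real \<Rightarrow> real" where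
  "psi P Q1 s1 s2 = lam P * q P 1 * q P 2 * eta_q P 1 * eta_q P 2
                      * s1 powr (- eta_q P 1) * s2 powr (- eta_q P 2)"
| "psi P Q2 s1 s2 = lam P * p P 1 * q P 2 * eta_p P 1 * eta_q P 2
                      * s1 powr (eta_p P 1) * s2 powr (- eta_q P 2)"
| "psi P Q3 s1 s2 = lam P * q P 1 * p P 2 * eta_q P 1 * eta_p P 2
                      * s1 powr (- eta_q P 1) * s2 powr (eta_p P 2)"
| "psi P Q4 s1 s2 = lam P * p P 1 * p P 2 * eta_p P 1 * eta_p P 2
                      * s1 powr (eta_p P 1) * s2 powr (eta_p P 2)"

definition zeta :: "kou \<Rightarrow> nat \<Rightarrow> nat \<Rightarrow> quadrant \<Rightarrow> nat \<Rightarrow> nat \<Rightarrow> nat \<Rightarrow> nat \<Rightarrow> real" where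
  "zeta P m1 m2 \<nu> a b k l =
     (mesh P m1 k powr (real a + alpha P \<nu>) - mesh P m1 (k - 1) powr (real a + alpha P \<nu>))
     * (mesh P m2 l powr (real b + beta P \<nu>) - mesh P m2 (l - 1) powr (real b + beta P \<nu>))
     / ((real a + alpha P \<nu>) * (real b + beta P \<nu>))"

definition delta :: "kou \<Rightarrow> nat \<Rightarrow> nat \<Rightarrow> nat \<Rightarrow> nat \<Rightarrow> real" where
  "delta P m1 m2 k l = (mesh P m1 k - mesh P m1 (k - 1)) * (mesh P m2 l - mesh P m2 (l - 1))"

definition gamma00 :: "kou \<Rightarrow> nat \<Rightarrow> nat \<Rightarrow> quadrant \<Rightarrow> nat \<Rightarrow> nat \<Rightarrow> real" where
  "gamma00 P m1 m2 \<nu> k l =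
     (mesh P m1 k * mesh P m2 l * zeta P m1 m2 \<nu> 0 0 k l
      - mesh P m2 l * zeta P m1 m2 \<nu> 1 0 k l
      - mesh P m1 k * zeta P m1 m2 \<nu> 0 1 k l
      + zeta P m1 m2 \<nu> 1 1 k l) / delta P m1 m2 k l"

definition gamma10 :: "kou \<Rightarrow> nat \<Rightarrow> nat \<Rightarrow> quadrant \<Rightarrow> nat \<Rightarrow> nat \<Rightarrow> real" where
  "gamma10 P m1 m2 \<nu> k l =
     (- mesh P m1 (k - 1) * mesh P m2 l * zeta P m1 m2 \<nu> 0 0 k l
      + mesh P m2 l * zeta P m1 m2 \<nu> 1 0 k l
      + mesh P m1 (k - 1) * zeta P m1 m2 \<nu> 0 1 k l
      - zeta P m1 m2 \<nu> 1 1 k l) / delta P m1 m2 k l"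

definition gamma01 :: "kou \<Rightarrow> nat \<Rightarrow> nat \<Rightarrow> quadrant \<Rightarrow> nat \<Rightarrow> nat \<Rightarrow> real" where
  "gamma01 P m1 m2 \<nu> k l =
     (- mesh P m1 k * mesh P m2 (l - 1) * zeta P m1 m2 \<nu> 0 0 k l
      + mesh P m2 (l - 1) * zeta P m1 m2 \<nu> 1 0 k l
      + mesh P m1 k * zeta P m1 m2 \<nu> 0 1 k l
      - zeta P m1 m2 \<nu> 1 1 k l) / delta P m1 m2 k l"

definition gamma11 :: "kou \<Rightarrow> nat \<Rightarrow> nat \<Rightarrow> quadrant \<Rightarrow> nat \<Rightarrow> nat \<Rightarrow> real" where
  "gamma11 P m1 m2 \<nu> k l =
     (mesh P m1 (k - 1) * mesh P m2 (l - 1) * zeta P m1 m2 \<nu> 0 0 k l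
      - mesh P m2 (l - 1) * zeta P m1 m2 \<nu> 1 0 k l
      - mesh P m1 (k - 1) * zeta P m1 m2 \<nu> 0 1 k l
      + zeta P m1 m2 \<nu> 1 1 k l) / delta P m1 m2 k l"

definition G :: "kou \<Rightarrow> nat \<Rightarrow> nat \<Rightarrow> (nat \<Rightarrow> nat \<Rightarrow> real) \<Rightarrow> quadrant \<Rightarrow> nat \<Rightarrow> nat \<Rightarrow> real" where
  "G P m1 m2 V \<nu> k l =
     gamma00 P m1 m2 \<nu> k l * V (k - 1) (l - 1) + gamma10 P m1 m2 \<nu> k l * V k (l - 1)
     + gamma01 P m1 m2 \<nu> k l * V (k - 1) l + gamma11 P m1 m2 \<nu> k l * V k l"

definition cell_range :: "bool \<Rightarrow> nat \<Rightarrow> nat \<Rightarrow> nat set" where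
  "cell_range far m i = (if far then {i + 1..m} else {1..i})"

definition J_approx ::
    "kou \<Rightarrow> nat \<Rightarrow> nat \<Rightarrow> (nat \<Rightarrow> nat \<Rightarrow> real) \<Rightarrow> quadrant \<Rightarrow> nat \<Rightarrow> nat \<Rightarrow> real" where
  "J_approx P m1 m2 V \<nu> i j =
     psi P \<nu> (mesh P m1 i) (mesh P m2 j)
     * (\<Sum>k\<in>cell_range (far1 \<nu>) m1 i. \<Sum>l\<in>cell_range (far2 \<nu>) m2 j. G P m1 m2 V \<nu> k l)"

text \<open>
  One-dimensional approximation on an edge of the domain. Here \<open>a\<close> is the asset whose price
  varies along the edge, \<open>m\<close> its number of cells, \<open>W\<close> the vector of values on the edge; the flag
  \<open>far\<close> distinguishes the pieces \<open>y < 1\<close> and \<open>y \<ge> 1\<close> of its jump density.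
\<close>

definition edge_exp :: "kou \<Rightarrow> nat \<Rightarrow> bool \<Rightarrow> real" where
  "edge_exp P a far = (if far then - eta_p P a else eta_q P a)"

definition edge_psi :: "kou \<Rightarrow> nat \<Rightarrow> bool \<Rightarrow> real \<Rightarrow> real" where
  "edge_psi P a far s =
     (if far then lam P * p P a * eta_p P a * s powr (eta_p P a)
      else lam P * q P a * eta_q P a * s powr (- eta_q P a))"

definition edge_zeta :: "kou \<Rightarrow> nat \<Rightarrow> nat \<Rightarrow> bool \<Rightarrow> nat \<Rightarrow> nat \<Rightarrow> real" where
  "edge_zeta P a m far c k =
     (mesh P m k powr (real c + edge_exp P a far)
      - mesh P m (k - 1) powr (real c + edge_exp P a far)) / (real c + edge_exp P a far)"

definition edge_gamma0 :: "kou \<Rightarrow> nat \<Rightarrow> nat \<Rightarrow> bool \<Rightarrow> nat \<Rightarrow> real" where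
  "edge_gamma0 P a m far k =
     (mesh P m k * edge_zeta P a m far 0 k - edge_zeta P a m far 1 k)
     / (mesh P m k - mesh P m (k - 1))"

definition edge_gamma1 :: "kou \<Rightarrow> nat \<Rightarrow> nat \<Rightarrow> bool \<Rightarrow> nat \<Rightarrow> real" where
  "edge_gamma1 P a m far k =
     (- mesh P m (k - 1) * edge_zeta P a m far 0 k + edge_zeta P a m far 1 k)
     / (mesh P m k - mesh P m (k - 1))"

definition edge_G :: "kou \<Rightarrow> nat \<Rightarrow> nat \<Rightarrow> (nat \<Rightarrow> real) \<Rightarrow> bool \<Rightarrow> nat \<Rightarrow> real" where
  "edge_G P a m W far k = edge_gamma0 P a m far k * W (k - 1) + edge_gamma1 P a m far k * W k"

definition edge_approx :: "kou \<Rightarrow> nat \<Rightarrow> nat \<Rightarrow> (nat \<Rightarrow> real) \<Rightarrow> nat \<Rightarrow> real" where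
  "edge_approx P a m W i =
     edge_psi P a False (mesh P m i) * (\<Sum>k = 1..i. edge_G P a m W False k)
     + edge_psi P a True (mesh P m i) * (\<Sum>k = i + 1..m. edge_G P a m W True k)"

definition integral_approx ::
    "kou \<Rightarrow> nat \<Rightarrow> nat \<Rightarrow> (nat \<Rightarrow> nat \<Rightarrow> real) \<Rightarrow> nat \<Rightarrow> nat \<Rightarrow> real" where
  "integral_approx P m1 m2 V i j =
     (if i = 0 \<and> j = 0 then lam P * V 0 0
      else if j = 0 then edge_approx P 1 m1 (\<lambda>k. V k 0) i
      else if i = 0 then edge_approx P 2 m2 (\<lambda>l. V 0 l) j
      else J_approx P m1 m2 V Q1 i j + J_approx P m1 m2 V Q2 i j
           + J_approx P m1 m2 V Q3 i j + J_approx P m1 m2 V Q4 i j)"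


section \<open>Arithmetic straight-line programs\<close>

text \<open>
  Every instruction performs exactly one basic arithmetic operation on two operands and stores the
  result. Constants are the quantities available upfront: a program does not depend on the
  vector of values \<open>V\<close>, which is only supplied in the initial store.
\<close>

datatype reg =
    In nat nat
  | Tmp nat
  | D quadrant nat nat
  | J quadrant nat nat
  | E nat bool nat
  | Out nat nat

datatype operand = Const real | Reg reg

datatype arith = Add | Sub | Mul | Div

datatype instr = Set (target: reg) (operation: arith) operand operand

type_synonym program = "instr list"

type_synonym store = "reg \<Rightarrow> real"

fun fetch :: "store \<Rightarrow> operand \<Rightarrow> real" where
  "fetch \<sigma> (Const c) = c"
| "fetch \<sigma> (Reg r) = \<sigma> r"

fun arith_fun :: "arith \<Rightarrow> real \<Rightarrow> real \<Rightarrow> real" where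
  "arith_fun Add = (+)" | "arith_fun Sub = (-)" | "arith_fun Mul = (*)" | "arith_fun Div = (/)"

fun step :: "instr \<Rightarrow> store \<Rightarrow> store" where
  "step (Set r f x y) \<sigma> = \<sigma>(r := arith_fun f (fetch \<sigma> x) (fetch \<sigma> y))"

fun init_store :: "(nat \<Rightarrow> nat \<Rightarrow> real) \<Rightarrow> store" where
  "init_store V (In k l) = V k l"
| "init_store V _ = 0"

definition run :: "program \<Rightarrow> (nat \<Rightarrow> nat \<Rightarrow> real) \<Rightarrow> store" where
  "run prog V = fold step prog (init_store V)"

definition num_ops :: "program \<Rightarrow> nat" where
  "num_ops prog = length prog"

definition count_ops :: "arith \<Rightarrow> program \<Rightarrow> nat" where
  "count_ops f prog = length (filter (\<lambda>c. operation c = f) prog)"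


section \<open>Evaluation by double cumulative sums\<close>

text \<open>
  The cells occurring in the sums of one direction, in the order in which they are accumulated:
  upwards from \<open>1\<close>, or downwards from \<open>m\<close> to \<open>2\<close>.
\<close>

definition cells :: "bool \<Rightarrow> nat \<Rightarrow> nat list" where
  "cells far m = (if far then rev [2..<Suc m] else [1..<Suc m])"

definition consecutive :: "nat list \<Rightarrow> (nat \<times> nat) list" where
  "consecutive ks = zip ks (tl ks)"

definition cell_prog :: "kou \<Rightarrow> nat \<Rightarrow> nat \<Rightarrow> quadrant \<Rightarrow> nat \<Rightarrow> nat \<Rightarrow> program" where
  "cell_prog P m1 m2 \<nu> k l =
    [Set (Tmp 0) Mul (Const (gamma00 P m1 m2 \<nu> k l)) (Reg (In (k - 1) (l - 1))),
     Set (Tmp 1) Mul (Const (gamma10 P m1 m2 \<nu> k l)) (Reg (In k (l - 1))),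
     Set (Tmp 2) Mul (Const (gamma01 P m1 m2 \<nu> k l)) (Reg (In (k - 1) l)),
     Set (Tmp 3) Mul (Const (gamma11 P m1 m2 \<nu> k l)) (Reg (In k l)),
     Set (Tmp 0) Add (Reg (Tmp 0)) (Reg (Tmp 1)),
     Set (Tmp 0) Add (Reg (Tmp 0)) (Reg (Tmp 2)),
     Set (D \<nu> k l) Add (Reg (Tmp 0)) (Reg (Tmp 3))]"

definition G_prog :: "kou \<Rightarrow> nat \<Rightarrow> nat \<Rightarrow> quadrant \<Rightarrow> program" where
  "G_prog P m1 m2 \<nu> =
    [c. k \<leftarrow> cells (far1 \<nu>) m1, l \<leftarrow> cells (far2 \<nu>) m2, c \<leftarrow> cell_prog P m1 m2 \<nu> k l]"

text \<open>The registers \<open>D \<nu> k l\<close> hold the values of \<open>G\<close> and are overwritten by their cumulative sums,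
  first in the second direction, then in the first one.\<close>

definition cumsum_prog :: "nat \<Rightarrow> nat \<Rightarrow> quadrant \<Rightarrow> program" where
  "cumsum_prog m1 m2 \<nu> =
    [Set (D \<nu> k l') Add (Reg (D \<nu> k l)) (Reg (D \<nu> k l')).
       k \<leftarrow> cells (far1 \<nu>) m1, (l, l') \<leftarrow> consecutive (cells (far2 \<nu>) m2)]
    @ [Set (D \<nu> k' l) Add (Reg (D \<nu> k l)) (Reg (D \<nu> k' l)).
       (k, k') \<leftarrow> consecutive (cells (far1 \<nu>) m1), l \<leftarrow> cells (far2 \<nu>) m2]"

text \<open>For the empty sums, the register \<open>D \<nu> (m1 + 1) j\<close> or \<open>D \<nu> i (m2 + 1)\<close> read here still has its
  initial value zero.\<close>

definition scale_prog :: "kou \<Rightarrow> nat \<Rightarrow> nat \<Rightarrow> quadrant \<Rightarrow> program" where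
  "scale_prog P m1 m2 \<nu> =
    [Set (J \<nu> i j) Mul (Const (psi P \<nu> (mesh P m1 i) (mesh P m2 j)))
       (Reg (D \<nu> (if far1 \<nu> then i + 1 else i) (if far2 \<nu> then j + 1 else j))).
       i \<leftarrow> [1..<Suc m1], j \<leftarrow> [1..<Suc m2]]"

definition J_prog :: "kou \<Rightarrow> nat \<Rightarrow> nat \<Rightarrow> quadrant \<Rightarrow> program" where
  "J_prog P m1 m2 \<nu> = G_prog P m1 m2 \<nu> @ cumsum_prog m1 m2 \<nu> @ scale_prog P m1 m2 \<nu>"

text \<open>In the edge program, \<open>inp\<close> and \<open>out\<close> are the registers of the values and of the results on the
  edge.\<close>

definition edge_part_prog :: "kou \<Rightarrow> nat \<Rightarrow> nat \<Rightarrow> (nat \<Rightarrow> reg) \<Rightarrow> bool \<Rightarrow> program" where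
  "edge_part_prog P a m inp far =
    [c. k \<leftarrow> cells far m,
        c \<leftarrow> [Set (Tmp 0) Mul (Const (edge_gamma0 P a m far k)) (Reg (inp (k - 1))),
              Set (Tmp 1) Mul (Const (edge_gamma1 P a m far k)) (Reg (inp k)),
              Set (E a far k) Add (Reg (Tmp 0)) (Reg (Tmp 1))]]
    @ [Set (E a far k') Add (Reg (E a far k)) (Reg (E a far k')).
        (k, k') \<leftarrow> consecutive (cells far m)]"

definition edge_prog ::
    "kou \<Rightarrow> nat \<Rightarrow> nat \<Rightarrow> (nat \<Rightarrow> reg) \<Rightarrow> (nat \<Rightarrow> reg) \<Rightarrow> program" where
  "edge_prog P a m inp out =
    edge_part_prog P a m inp False @ edge_part_prog P a m inp True
    @ [c. i \<leftarrow> [1..<Suc m],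
          c \<leftarrow> [Set (Tmp 0) Mul (Const (edge_psi P a False (mesh P m i))) (Reg (E a False i)),
                Set (Tmp 1) Mul (Const (edge_psi P a True (mesh P m i))) (Reg (E a True (i + 1))),
                Set (out i) Add (Reg (Tmp 0)) (Reg (Tmp 1))]]"

definition boundary_prog :: "kou \<Rightarrow> nat \<Rightarrow> nat \<Rightarrow> program" where
  "boundary_prog P m1 m2 =
    edge_prog P 1 m1 (\<lambda>k. In k 0) (\<lambda>i. Out i 0)
    @ edge_prog P 2 m2 (\<lambda>l. In 0 l) (\<lambda>j. Out 0 j)
    @ [Set (Out 0 0) Mul (Const (lam P)) (Reg (In 0 0))]"

text \<open>\<open>eval_prog\<close> evaluates the approximations of the four integrals at all grid points off the axes
  and the reduced approximation on the axes; \<open>full_prog\<close> also adds up the four contributions.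
  The count \<open>4 * 10 * m1 * m2\<close> is that of \<open>eval_prog\<close>: it does not include the three additions per
  grid point of the final sum.\<close>

definition eval_prog :: "kou \<Rightarrow> nat \<Rightarrow> nat \<Rightarrow> program" where
  "eval_prog P m1 m2 =
    J_prog P m1 m2 Q1 @ J_prog P m1 m2 Q2 @ J_prog P m1 m2 Q3 @ J_prog P m1 m2 Q4
    @ boundary_prog P m1 m2"

definition assemble_prog :: "nat \<Rightarrow> nat \<Rightarrow> program" where
  "assemble_prog m1 m2 =
    [c. i \<leftarrow> [1..<Suc m1], j \<leftarrow> [1..<Suc m2],
        c \<leftarrow> [Set (Tmp 0) Add (Reg (J Q1 i j)) (Reg (J Q2 i j)),
              Set (Tmp 0) Add (Reg (Tmp 0)) (Reg (J Q3 i j)),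
              Set (Out i j) Add (Reg (Tmp 0)) (Reg (J Q4 i j))]]"

definition full_prog :: "kou \<Rightarrow> nat \<Rightarrow> nat \<Rightarrow> program" where
  "full_prog P m1 m2 = eval_prog P m1 m2 @ assemble_prog m1 m2"


section \<open>The computational tasks\<close>

text \<open>The result registers are arbitrary, so that these predicates make sense for every program.\<close>

definition computes_parts ::
    "kou \<Rightarrow> nat \<Rightarrow> nat \<Rightarrow> program \<Rightarrow> (quadrant \<Rightarrow> nat \<Rightarrow> nat \<Rightarrow> reg) \<Rightarrow> (nat \<Rightarrow> nat \<Rightarrow> reg) \<Rightarrow> bool" where
  "computes_parts P m1 m2 prog part out \<longleftrightarrow>
    (\<forall>V. (\<forall>\<nu>. \<forall>i\<in>{1..m1}. \<forall>j\<in>{1..m2}. run prog V (part \<nu> i j) = J_approx P m1 m2 V \<nu> i j)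
       \<and> (\<forall>i\<le>m1. \<forall>j\<le>m2. i = 0 \<or> j = 0 \<longrightarrow> run prog V (out i j) = integral_approx P m1 m2 V i j))"

definition computes_integral ::
    "kou \<Rightarrow> nat \<Rightarrow> nat \<Rightarrow> program \<Rightarrow> (nat \<Rightarrow> nat \<Rightarrow> reg) \<Rightarrow> bool" where
  "computes_integral P m1 m2 prog out \<longleftrightarrow>
    (\<forall>V. \<forall>i\<le>m1. \<forall>j\<le>m2. run prog V (out i j) = integral_approx P m1 m2 V i j)"

definition grid_points :: "nat \<Rightarrow> nat \<Rightarrow> nat" where
  "grid_points m1 m2 = (m1 + 1) * (m2 + 1)"

text \<open>\<open>leading N M\<close>: \<open>N\<close> equals \<open>M\<close> to leading order for large numbers of grid cells in both
  directions.\<close>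

definition leading :: "(nat \<Rightarrow> nat \<Rightarrow> nat) \<Rightarrow> (nat \<Rightarrow> nat \<Rightarrow> nat) \<Rightarrow> bool" where
  "leading N M \<longleftrightarrow>
    asymp_equiv (\<lambda>(m1, m2). real (N m1 m2)) (sequentially \<times>\<^sub>F sequentially)
      (\<lambda>(m1, m2). real (M m1 m2))"

end

theory Submission
  imports Defs
begin

text \<open>
  The upper bound is the observation that all the double sums of one quadrant together form one
  table of partial sums. Once each \<open>G\<close> has been computed (four multiplications and three additions
  per cell), a pass along the second direction followed by a pass along the first one replaces it by
  its double cumulative sum at the price of two additions per cell, and one multiplication per grid
  point by a value of \<open>psi\<close> finishes the quadrant: ten operations per cell, hence forty for the four
  quadrants. In a direction with \<open>y \<ge> 1\<close> the sums run from the far end, and the first cell, whose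
  sum no grid point with a positive index needs, is left out. This, the first row of each cumulative pass and
  the one-dimensional work on the axes change the count by at most a multiple of \<open>m1 + m2\<close>. Counts
  of the form \<open>c * m1 * m2 + O(m1 + m2)\<close> (\<open>bilinear_growth\<close>) are closed under addition and determine
  the leading order (\<open>leading_bilinear_growth\<close>).

  The programs are verified from two facts. A loop whose passes do not interfere may be studied one
  pass at a time (\<open>fold_step_block\<close>), and adding each row of a table to the next one produces partial
  sums in place (\<open>fold_step_cumsum\<close>). Everything else is bookkeeping about the registers written by
  each part.

  For optimality, the approximation at the corner \<open>(m1, m2)\<close> suffices. There only the quadrant
  \<open>Q1\<close> contributes, and its sum runs over all cells. Since the density and the bilinear interpolant
  are products, each weight of \<open>Q1\<close> is a product of two one-dimensional weights, and these are positive as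
  moments of hat functions (\<open>hat_moments_pos\<close>). Hence the corner value depends on every
  one of the \<open>(m1 + 1) * (m2 + 1)\<close> values of \<open>V\<close> (\<open>J_approx_unit_pos\<close>). An instruction reads at most
  two registers, so a program with \<open>n\<close> instructions can make its result depend on at most \<open>2 * n + 1\<close>
  inputs (\<open>num_ops_lower_bound\<close>).
\<close>

section \<open>Loops in straight-line programs\<close>

definition writes :: "program \<Rightarrow> reg set" where
  "writes prog = target ` set prog"

lemma writes_simps [simp]:
  "writes [] = {}"
  "writes (c # cs) = insert (target c) (writes cs)"
  "writes (cs @ ds) = writes cs \<union> writes ds"
  "writes (concat css) = (\<Union>cs\<in>set css. writes cs)"
  "writes (map f xs) = (\<lambda>x. target (f x)) ` set xs"
  by (auto simp: writes_def)

lemma fold_step_unwritten: "r \<notin> writes prog \<Longrightarrow> fold step prog \<sigma> r = \<sigma> r"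
proof (induction prog arbitrary: \<sigma>)
  case (Cons c prog)
  then show ?case by (cases c) auto
qed simp

text \<open>
  A pass of the loop starts from a store in which the temporaries hold leftovers of earlier passes,
  so it is examined from any store that agrees with the initial one on the registers \<open>S\<close> alone. Only
  the other passes have to leave \<open>S\<close> and the result \<open>r\<close> untouched: the pass itself may overwrite \<open>S\<close>,
  which admits loops working in place.
\<close>
lemma fold_step_block:
  assumes x: "x \<in> set xs" "distinct xs"
    and block: "\<And>\<tau>. (\<And>s. s \<in> S \<Longrightarrow> \<tau> s = \<sigma> s) \<Longrightarrow> fold step (body x) \<tau> r = v"
    and others: "\<And>y. y \<in> set xs \<Longrightarrow> y \<noteq> x \<Longrightarrow> writes (body y) \<inter> insert r S = {}"
  shows "fold step (concat (map body xs)) \<sigma> r = v"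
proof -
  obtain as bs where xs: "xs = as @ x # bs"
    using x(1) by (auto simp: in_set_conv_decomp)
  have "y \<noteq> x" if "y \<in> set as \<union> set bs" for y
    using that x(2) xs by auto
  then have unwritten: "s \<notin> writes (concat (map body as))" "s \<notin> writes (concat (map body bs))"
    if "s \<in> insert r S" for s
    using others that by (fastforce simp: xs)+
  have "fold step (body x) (fold step (concat (map body as)) \<sigma>) r = v"
    using unwritten(1) by (intro block fold_step_unwritten) blast
  then show ?thesis
    using unwritten(2) by (simp add: xs fold_step_unwritten)
qed

text \<open>
  The passive index \<open>y\<close> lets the same statement serve for the cumulation of whole rows of a table and,
  with a single \<open>y\<close>, of a vector. The induction takes off the front of \<open>ks\<close>: the first pass merges
  row \<open>k\<close> into row \<open>k'\<close>, and the other passes cumulate the table that begins with the merged row.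
\<close>
lemma fold_step_cumsum:
  assumes "n < length ks" "y \<in> set ys" "distinct ks" "distinct ys"
    and "\<And>k l y z. k \<in> set ks \<Longrightarrow> l \<in> set ks \<Longrightarrow> y \<in> set ys \<Longrightarrow> z \<in> set ys \<Longrightarrow>
           f k y = f l z \<Longrightarrow> k = l \<and> y = z"
  shows "fold step (concat (map (\<lambda>(k, k'). map (\<lambda>y. Set (f k' y) Add (Reg (f k y)) (Reg (f k' y))) ys)
             (consecutive ks))) \<sigma> (f (ks ! n) y)
         = (\<Sum>i\<le>n. \<sigma> (f (ks ! i) y))"
  using assms
proof (induction ks arbitrary: n \<sigma>)
  case Nil
  then show ?case by simp
next
  case (Cons k ks)
  show ?case
  proof (cases ks)
    case Nil
    then show ?thesis using Cons.prems by (simp add: consecutive_def)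
  next
    case (Cons k' ks')
    define row where "row = map (\<lambda>y. Set (f k' y) Add (Reg (f k y)) (Reg (f k' y))) ys"
    define rest where "rest = concat (map (\<lambda>(k, k'). map (\<lambda>y. Set (f k' y) Add (Reg (f k y)) (Reg (f k' y))) ys)
             (consecutive ks))"
    have split: "concat (map (\<lambda>(k, k'). map (\<lambda>y. Set (f k' y) Add (Reg (f k y)) (Reg (f k' y))) ys)
             (consecutive (k # ks))) = row @ rest"
      by (simp add: consecutive_def Cons row_def rest_def)
    have inj: "f a y = f b z \<longleftrightarrow> a = b \<and> y = z"
      if "a \<in> set (k # ks)" "b \<in> set (k # ks)" "y \<in> set ys" "z \<in> set ys" for a b y z
      using Cons.prems(5) that by blast
    have k': "k' \<in> set ks" "k \<noteq> k'"
      using Cons.prems(3) Cons by auto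
    have row_k': "fold step row \<sigma> (f k' y) = \<sigma> (f k y) + \<sigma> (f k' y)"
    proof -
      have "row = concat (map (\<lambda>y. [Set (f k' y) Add (Reg (f k y)) (Reg (f k' y))]) ys)"
        by (simp add: row_def)
      also have "fold step \<dots> \<sigma> (f k' y) = \<sigma> (f k y) + \<sigma> (f k' y)"
        by (rule fold_step_block[where x = y and S = "{f k y, f k' y}"])
           (use Cons.prems k' inj in auto)
      finally show ?thesis .
    qed
    have row_other: "fold step row \<sigma> (f a y) = \<sigma> (f a y)" if "a \<in> set (k # ks)" "a \<noteq> k'" for a
      by (rule fold_step_unwritten) (use that k' inj Cons.prems(2) in \<open>auto simp: row_def\<close>)
    show ?thesis
    proof (cases n)
      case 0
      have "f k y \<notin> writes rest"
      proof
        assume "f k y \<in> writes rest"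
        then obtain a b z where ab: "(a, b) \<in> set (consecutive ks)" "z \<in> set ys" "f k y = f b z"
          by (auto simp: rest_def)
        have "b \<in> set ks" if "b \<in> set (tl ks)"
          using that by (simp add: Cons)
        then have "b \<in> set ks"
          using ab(1) by (auto simp: consecutive_def dest: set_zip_rightD)
        then show False
          using inj[of k b y z] ab Cons.prems(2,3) by auto
      qed
      then show ?thesis
        unfolding split using row_other[of k] k' 0 by (simp add: fold_step_unwritten)
    next
      case (Suc n')
      have n': "n' < length ks"
        using Cons.prems(1) Suc by simp
      have "fold step rest (fold step row \<sigma>) (f (ks ! n') y)
            = (\<Sum>i\<le>n'. fold step row \<sigma> (f (ks ! i) y))"
        unfolding rest_def by (rule Cons.IH) (use Cons.prems n' in auto)
      also have "\<dots> = fold step row \<sigma> (f k' y) + (\<Sum>i<n'. fold step row \<sigma> (f (ks ! Suc i) y))"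
        by (subst sum.atMost_shift) (simp add: Cons)
      also have "(\<Sum>i<n'. fold step row \<sigma> (f (ks ! Suc i) y)) = (\<Sum>i<n'. \<sigma> (f (ks ! Suc i) y))"
      proof (rule sum.cong[OF refl])
        fix i assume "i \<in> {..<n'}"
        then have "ks ! Suc i \<in> set ks" "ks ! Suc i \<noteq> k'"
          using n' Cons.prems(3) Cons by (auto simp: nth_eq_iff_index_eq)
        then show "fold step row \<sigma> (f (ks ! Suc i) y) = \<sigma> (f (ks ! Suc i) y)"
          by (intro row_other) auto
      qed
      also have "fold step row \<sigma> (f k' y) + (\<Sum>i<n'. \<sigma> (f (ks ! Suc i) y))
                 = (\<Sum>i\<le>n. \<sigma> (f ((k # ks) ! i) y))"
        unfolding row_k' Suc
        by (simp add: sum.atMost_shift sum.lessThan_Suc_shift Cons del: sum.lessThan_Suc)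
      finally show ?thesis
        unfolding split by (simp add: Suc)
    qed
  qed
qed

section \<open>Cumulative sums over the cells\<close>

lemma distinct_cells [simp]: "distinct (cells far m)"
  by (simp add: cells_def)

lemma set_cells: "set (cells far m) = (if far then {2..m} else {1..m})"
  by (auto simp: cells_def)

lemma length_cells: "length (cells far m) = (if far then m - 1 else m)"
  by (simp add: cells_def del: upt_Suc)

definition cells_upto :: "bool \<Rightarrow> nat \<Rightarrow> nat \<Rightarrow> nat set" where
  "cells_upto far m k = (if far then {k..m} else {1..k})"

lemma sum_cells_prefix:
  assumes "n < length (cells far m)"
  shows "(\<Sum>i\<le>n. g (cells far m ! i)) = sum g (cells_upto far m (cells far m ! n))"
proof (cases far)
  case True
  have nth: "cells True m ! i = m - i" if "i < m - 1" for i
    using that True by (simp add: cells_def rev_nth del: upt_Suc)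
  have "(\<Sum>i\<le>n. g (cells far m ! i)) = (\<Sum>i\<le>n. g (m - i))"
    using assms True by (intro sum.cong refl) (simp add: nth length_cells)
  also have "\<dots> = sum g {m - n..m}"
    using assms True
    by (intro sum.reindex_bij_witness[of _ "\<lambda>k. m - k" "\<lambda>i. m - i"]) (auto simp: length_cells)
  finally show ?thesis
    using assms True by (simp add: cells_upto_def nth length_cells)
next
  case False
  have nth: "cells False m ! i = i + 1" if "i < m" for i
    using that by (simp add: cells_def del: upt_Suc)
  have "(\<Sum>i\<le>n. g (cells far m ! i)) = (\<Sum>i\<le>n. g (i + 1))"
    using assms False by (intro sum.cong refl) (simp add: nth length_cells)
  also have "\<dots> = sum g {1..n + 1}"
    by (intro sum.reindex_bij_witness[of _ "\<lambda>k. k - 1" "\<lambda>i. i + 1"]) auto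
  finally show ?thesis
    using assms False by (simp add: cells_upto_def nth length_cells)
qed

lemma fold_step_cumsum_cells:
  assumes "k \<in> set (cells far m)" "y \<in> set ys" "distinct ys"
    and "\<And>k l y z. f k y = f l z \<Longrightarrow> k = l \<and> y = z"
  shows "fold step (concat (map (\<lambda>(k, k'). map (\<lambda>y. Set (f k' y) Add (Reg (f k y)) (Reg (f k' y))) ys)
             (consecutive (cells far m)))) \<sigma> (f k y)
         = (\<Sum>k'\<in>cells_upto far m k. \<sigma> (f k' y))"
proof -
  obtain n where n: "n < length (cells far m)" "k = cells far m ! n"
    using assms(1) by (metis in_set_conv_nth)
  show ?thesis
    unfolding n(2)
    using assms n(1) by (subst fold_step_cumsum) (auto simp: sum_cells_prefix[where g = "\<lambda>k. \<sigma> (f k y)"])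
qed

lemma fold_step_cumsum_cells_single:
  assumes "k \<in> set (cells far m)" "inj f"
  shows "fold step (map (\<lambda>(k, k'). Set (f k') Add (Reg (f k)) (Reg (f k'))) (consecutive (cells far m)))
           \<sigma> (f k)
         = (\<Sum>k'\<in>cells_upto far m k. \<sigma> (f k'))"
  using fold_step_cumsum_cells[of k far m "()" "[()]" "\<lambda>k _. f k" \<sigma>] assms
  by (simp add: inj_def case_prod_unfold)

section \<open>Correctness of the programs for the double integral\<close>

lemma cell_prog_correct:
  assumes "\<And>k l. \<sigma> (In k l) = V k l"
  shows "fold step (cell_prog P m1 m2 \<nu> k l) \<sigma> (D \<nu> k l) = G P m1 m2 V \<nu> k l"
  using assms by (simp add: cell_prog_def G_def)

lemma concat_map_product:
  "concat (map (\<lambda>(x, y). f x y) (List.product xs ys)) = concat (map (\<lambda>x. concat (map (f x) ys)) xs)"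
  by (induction xs) (auto simp: comp_def)

text \<open>
  Nested loops are flattened to loops over index pairs, so that the independence of their passes has
  to be examined only once.
\<close>
lemma G_prog_as_blocks:
  "G_prog P m1 m2 \<nu> = concat (map (\<lambda>(k, l). cell_prog P m1 m2 \<nu> k l)
     (List.product (cells (far1 \<nu>) m1) (cells (far2 \<nu>) m2)))"
  by (simp add: G_prog_def concat_map_product)

lemma writes_cell_prog: "writes (cell_prog P m1 m2 \<nu> k l) = {Tmp 0, Tmp 1, Tmp 2, Tmp 3, D \<nu> k l}"
  by (auto simp: cell_prog_def)

lemma G_prog_correct:
  assumes "\<And>k l. \<sigma> (In k l) = V k l" "k \<in> set (cells (far1 \<nu>) m1)" "l \<in> set (cells (far2 \<nu>) m2)"
  shows "fold step (G_prog P m1 m2 \<nu>) \<sigma> (D \<nu> k l) = G P m1 m2 V \<nu> k l"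
  unfolding G_prog_as_blocks
  by (rule fold_step_block[where x = "(k, l)" and S = "{In k l |k l. True}"])
     (use assms in \<open>auto simp: distinct_product writes_cell_prog intro!: cell_prog_correct\<close>)

lemma writes_G_prog:
  "writes (G_prog P m1 m2 \<nu>) \<subseteq> {Tmp 0, Tmp 1, Tmp 2, Tmp 3} \<union>
     {D \<nu> k l |k l. k \<in> set (cells (far1 \<nu>) m1) \<and> l \<in> set (cells (far2 \<nu>) m2)}"
  by (auto simp: G_prog_as_blocks writes_cell_prog)

lemma consecutive_in_set:
  assumes "(k, l) \<in> set (consecutive ks)"
  shows "k \<in> set ks" "l \<in> set ks"
  using assms by (cases ks; auto simp: consecutive_def dest: set_zip_leftD set_zip_rightD)+

lemma writes_cumsum_prog:
  "writes (cumsum_prog m1 m2 \<nu>) \<subseteq>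
     {D \<nu> k l |k l. k \<in> set (cells (far1 \<nu>) m1) \<and> l \<in> set (cells (far2 \<nu>) m2)}"
  unfolding cumsum_prog_def writes_simps using consecutive_in_set(2) by fastforce

text \<open>
  The first half of the program is a loop over \<open>k\<close> whose passes work in place on different rows; the
  second half adds the resulting rows up.
\<close>
lemma cumsum_prog_correct:
  assumes "k \<in> set (cells (far1 \<nu>) m1)" "l \<in> set (cells (far2 \<nu>) m2)"
  shows "fold step (cumsum_prog m1 m2 \<nu>) \<sigma> (D \<nu> k l)
    = (\<Sum>k'\<in>cells_upto (far1 \<nu>) m1 k. \<Sum>l'\<in>cells_upto (far2 \<nu>) m2 l. \<sigma> (D \<nu> k' l'))"
proof -
  define rows where "rows = concat (map (\<lambda>k. map (\<lambda>(l, l'). Set (D \<nu> k l') Add (Reg (D \<nu> k l)) (Reg (D \<nu> k l')))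
      (consecutive (cells (far2 \<nu>) m2))) (cells (far1 \<nu>) m1))"
  have rows: "fold step rows \<sigma> (D \<nu> k' l) = (\<Sum>l'\<in>cells_upto (far2 \<nu>) m2 l. \<sigma> (D \<nu> k' l'))"
    if "k' \<in> set (cells (far1 \<nu>) m1)" for k'
    unfolding rows_def
  proof (rule fold_step_block[where x = k' and S = "{D \<nu> k' l |l. True}"])
    fix \<tau> assume "\<And>s. s \<in> {D \<nu> k' l |l. True} \<Longrightarrow> \<tau> s = \<sigma> s"
    then show "fold step (map (\<lambda>(l, l'). Set (D \<nu> k' l') Add (Reg (D \<nu> k' l)) (Reg (D \<nu> k' l')))
        (consecutive (cells (far2 \<nu>) m2))) \<tau> (D \<nu> k' l)
      = (\<Sum>l'\<in>cells_upto (far2 \<nu>) m2 l. \<sigma> (D \<nu> k' l'))"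
      using assms(2) by (subst fold_step_cumsum_cells_single) (auto simp: inj_def)
  qed (use that in auto)
  have "cells_upto (far1 \<nu>) m1 k \<subseteq> set (cells (far1 \<nu>) m1)"
    using assms(1) by (auto simp: cells_upto_def set_cells split: if_splits)
  moreover have "fold step (cumsum_prog m1 m2 \<nu>) \<sigma> (D \<nu> k l)
    = (\<Sum>k'\<in>cells_upto (far1 \<nu>) m1 k. fold step rows \<sigma> (D \<nu> k' l))"
    unfolding cumsum_prog_def rows_def[symmetric] fold_append comp_apply
    by (rule fold_step_cumsum_cells) (use assms in \<open>auto simp: cells_def\<close>)
  ultimately show ?thesis
    using rows by (auto intro!: sum.cong)
qed

text \<open>
  In a direction with \<open>y \<ge> 1\<close> the sum of a grid point begins with the cell above it. For the last grid
  point the index is \<open>m + 1\<close>; no cell has this index, and a register with it is never written.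
\<close>
definition cum_index :: "bool \<Rightarrow> nat \<Rightarrow> nat" where
  "cum_index far i = (if far then i + 1 else i)"

lemma cells_upto_cum_index: "cells_upto far m (cum_index far i) = cell_range far m i"
  by (simp add: cells_upto_def cum_index_def cell_range_def)

lemma cell_range_empty:
  "i \<in> {1..m} \<Longrightarrow> cum_index far i \<notin> set (cells far m) \<Longrightarrow> cell_range far m i = {}"
  by (auto simp: cum_index_def set_cells cell_range_def split: if_splits)

lemma cell_range_cells: "i \<in> {1..m} \<Longrightarrow> cell_range far m i \<subseteq> set (cells far m)"
  by (auto simp: set_cells cell_range_def)

lemma scale_prog_as_blocks:
  "scale_prog P m1 m2 \<nu> = concat (map (\<lambda>(i, j).
      [Set (J \<nu> i j) Mul (Const (psi P \<nu> (mesh P m1 i) (mesh P m2 j)))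
       (Reg (D \<nu> (cum_index (far1 \<nu>) i) (cum_index (far2 \<nu>) j)))])
     (List.product [1..<Suc m1] [1..<Suc m2]))"
  by (simp add: scale_prog_def cum_index_def concat_map_product concat_map_singleton del: upt_Suc)

lemma scale_prog_correct:
  assumes "i \<in> {1..m1}" "j \<in> {1..m2}"
  shows "fold step (scale_prog P m1 m2 \<nu>) \<sigma> (J \<nu> i j) = psi P \<nu> (mesh P m1 i) (mesh P m2 j)
      * \<sigma> (D \<nu> (cum_index (far1 \<nu>) i) (cum_index (far2 \<nu>) j))"
  unfolding scale_prog_as_blocks
  by (rule fold_step_block[where x = "(i, j)" and
        S = "{D \<nu> (cum_index (far1 \<nu>) i) (cum_index (far2 \<nu>) j)}"])
     (use assms in \<open>auto simp: distinct_product simp del: upt_Suc\<close>)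

lemma writes_scale_prog: "writes (scale_prog P m1 m2 \<nu>) \<subseteq> {J \<nu> i j |i j. True}"
  by (auto simp: scale_prog_as_blocks)

lemma writes_J_prog:
  "writes (J_prog P m1 m2 \<nu>) \<subseteq> {Tmp 0, Tmp 1, Tmp 2, Tmp 3} \<union> {D \<nu> k l |k l. True} \<union> {J \<nu> i j |i j. True}"
  using writes_G_prog[of P m1 m2 \<nu>] writes_cumsum_prog[of m1 m2 \<nu>] writes_scale_prog[of P m1 m2 \<nu>]
  unfolding J_prog_def writes_simps by blast

text \<open>
  The registers \<open>D\<close> must start at zero on account of the empty sums, which are read from registers
  that no instruction writes.
\<close>
lemma J_prog_correct:
  assumes inp: "\<And>k l. \<sigma> (In k l) = V k l"
    and zero: "\<And>k l. \<sigma> (D \<nu> k l) = 0"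
    and ij: "i \<in> {1..m1}" "j \<in> {1..m2}"
  shows "fold step (J_prog P m1 m2 \<nu>) \<sigma> (J \<nu> i j) = J_approx P m1 m2 V \<nu> i j"
proof -
  define k where "k = cum_index (far1 \<nu>) i"
  define l where "l = cum_index (far2 \<nu>) j"
  define \<tau> where "\<tau> = fold step (G_prog P m1 m2 \<nu>) \<sigma>"
  have "fold step (cumsum_prog m1 m2 \<nu>) \<tau> (D \<nu> k l)
        = (\<Sum>k\<in>cell_range (far1 \<nu>) m1 i. \<Sum>l\<in>cell_range (far2 \<nu>) m2 j. G P m1 m2 V \<nu> k l)"
  proof (cases "k \<in> set (cells (far1 \<nu>) m1) \<and> l \<in> set (cells (far2 \<nu>) m2)")
    case True
    have "\<tau> (D \<nu> k' l') = G P m1 m2 V \<nu> k' l'"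
      if "k' \<in> cell_range (far1 \<nu>) m1 i" "l' \<in> cell_range (far2 \<nu>) m2 j" for k' l'
      unfolding \<tau>_def
      using that cell_range_cells[OF ij(1), of "far1 \<nu>"] cell_range_cells[OF ij(2), of "far2 \<nu>"]
      by (intro G_prog_correct inp) auto
    with True show ?thesis
      by (subst cumsum_prog_correct) (auto simp: k_def l_def cells_upto_cum_index)
  next
    case False
    then have "D \<nu> k l \<notin> writes (G_prog P m1 m2 \<nu>)" "D \<nu> k l \<notin> writes (cumsum_prog m1 m2 \<nu>)"
      using writes_G_prog[of P m1 m2 \<nu>] writes_cumsum_prog[of m1 m2 \<nu>] by auto
    moreover have "cell_range (far1 \<nu>) m1 i = {} \<or> cell_range (far2 \<nu>) m2 j = {}"
      using False cell_range_empty[OF ij(1), of "far1 \<nu>"] cell_range_empty[OF ij(2), of "far2 \<nu>"]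
      unfolding k_def l_def by auto
    ultimately show ?thesis
      by (auto simp: \<tau>_def fold_step_unwritten zero)
  qed
  then show ?thesis
    using ij by (simp add: J_prog_def scale_prog_correct J_approx_def k_def l_def \<tau>_def)
qed

section \<open>Correctness of the programs on the axes and of the full programs\<close>
lemma writes_edge_part_prog:
  "writes (edge_part_prog P a m inp far) \<subseteq> {Tmp 0, Tmp 1} \<union> E a far ` set (cells far m)"
  by (auto simp: edge_part_prog_def dest: consecutive_in_set(2))

lemma edge_part_prog_correct:
  assumes inp: "\<And>k. \<sigma> (inp k) = W k" "\<And>k. inp k \<notin> range Tmp \<union> range (E a far)"
    and k: "k \<in> set (cells far m)"
  shows "fold step (edge_part_prog P a m inp far) \<sigma> (E a far k)
    = (\<Sum>k\<in>cells_upto far m k. edge_G P a m W far k)"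
proof -
  define body where "body k =
    [Set (Tmp 0) Mul (Const (edge_gamma0 P a m far k)) (Reg (inp (k - 1))),
     Set (Tmp 1) Mul (Const (edge_gamma1 P a m far k)) (Reg (inp k)),
     Set (E a far k) Add (Reg (Tmp 0)) (Reg (Tmp 1))]" for k
  have inp': "inp k \<noteq> Tmp i" "inp k \<noteq> E a far i" for k i
    using inp(2)[of k] by auto
  have blocks: "fold step (concat (map body (cells far m))) \<sigma> (E a far k) = edge_G P a m W far k"
    if "k \<in> set (cells far m)" for k
    by (rule fold_step_block[where x = k and S = "range inp"])
       (use that in \<open>auto simp: body_def edge_G_def inp inp' inp'[symmetric]\<close>)
  have "cells_upto far m k \<subseteq> set (cells far m)"
    using k by (auto simp: cells_upto_def set_cells split: if_splits)
  moreover have "edge_part_prog P a m inp far = concat (map body (cells far m))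
      @ map (\<lambda>(k, k'). Set (E a far k') Add (Reg (E a far k)) (Reg (E a far k'))) (consecutive (cells far m))"
    by (simp add: edge_part_prog_def body_def[abs_def])
  ultimately show ?thesis
    using k blocks by (auto simp: fold_step_cumsum_cells_single inj_def intro!: sum.cong)
qed

lemma writes_edge_prog:
  "writes (edge_prog P a m inp out) \<subseteq> {Tmp 0, Tmp 1} \<union> {E a far k |far k. True} \<union> out ` {1..m}"
proof -
  have "writes (edge_part_prog P a m inp far) \<subseteq> {Tmp 0, Tmp 1} \<union> {E a far k |far k. True}" for far
    by (rule order_trans[OF writes_edge_part_prog]) auto
  from this[of False] this[of True] show ?thesis
    unfolding edge_prog_def writes_simps by (intro Un_least) (auto simp del: upt_Suc)
qed

lemma edge_prog_correct:
  assumes inp: "\<And>k. \<sigma> (inp k) = W k" "\<And>k. inp k \<in> {In k l |k l. True}"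
    and zero: "\<And>far k. \<sigma> (E a far k) = 0"
    and out: "inj out" "\<And>i. out i \<in> {Out k l |k l. True}"
    and i: "i \<in> {1..m}"
  shows "fold step (edge_prog P a m inp out) \<sigma> (out i) = edge_approx P a m W i"
proof -
  define near where "near = edge_part_prog P a m inp False"
  define far where "far = edge_part_prog P a m inp True"
  define body where "body i =
     [Set (Tmp 0) Mul (Const (edge_psi P a False (mesh P m i))) (Reg (E a False i)),
      Set (Tmp 1) Mul (Const (edge_psi P a True (mesh P m i))) (Reg (E a True (i + 1))),
      Set (out i) Add (Reg (Tmp 0)) (Reg (Tmp 1))]" for i
  have inp': "inp k \<notin> range Tmp \<union> range (E a b)" for k b
    using inp(2)[of k] by auto
  have out': "out k \<noteq> Tmp i" "out k \<noteq> E a far i" for k i far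
    using out(2)[of k] by auto
  have E_near: "fold step far (fold step near \<sigma>) (E a False i) = (\<Sum>k = 1..i. edge_G P a m W False k)"
  proof -
    have "E a False i \<notin> writes far"
      using writes_edge_part_prog[of P a m inp True] by (auto simp: far_def)
    then show ?thesis
      using i unfolding near_def
      by (simp add: fold_step_unwritten)
         (subst edge_part_prog_correct[of _ inp W, OF inp(1) inp'], auto simp: set_cells cells_upto_def)
  qed
  have E_far: "fold step far (fold step near \<sigma>) (E a True (i + 1)) = (\<Sum>k = i + 1..m. edge_G P a m W True k)"
  proof (cases "i = m")
    case True
    \<comment> \<open>an empty sum, read from a register that keeps its initial value\<close>
    have "E a True (i + 1) \<notin> writes near" "E a True (i + 1) \<notin> writes far"
      using writes_edge_part_prog[of P a m inp True] writes_edge_part_prog[of P a m inp False] True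
      by (auto simp: near_def far_def set_cells)
    then show ?thesis
      using True zero by (simp add: fold_step_unwritten)
  next
    case False
    have "fold step near \<sigma> (inp k) = W k" for k
    proof -
      have "inp k \<notin> writes near"
        using writes_edge_part_prog[of P a m inp False] inp'[of k False] by (auto simp: near_def)
      then show ?thesis
        by (simp add: fold_step_unwritten inp)
    qed
    then show ?thesis
      using i False unfolding far_def
      by (subst edge_part_prog_correct[of _ inp W, OF _ inp']) (auto simp: set_cells cells_upto_def)
  qed
  have "fold step (concat (map body [1..<Suc m])) (fold step far (fold step near \<sigma>)) (out i)
        = edge_approx P a m W i"
    by (rule fold_step_block[where x = i and S = "{E a False i, E a True (i + 1)}"])
       (use i E_near E_far out out' in \<open>auto simp: body_def edge_approx_def inj_eq simp del: upt_Suc\<close>)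
  then show ?thesis
    by (simp add: edge_prog_def near_def far_def body_def[abs_def] del: upt_Suc)
qed

lemma writes_boundary_prog:
  "writes (boundary_prog P m1 m2) \<subseteq>
     {Tmp 0, Tmp 1} \<union> {E a far k |a far k. True} \<union> {Out i j |i j. True}"
  using writes_edge_prog[of P 1 m1 "\<lambda>k. In k 0" "\<lambda>i. Out i 0"]
    writes_edge_prog[of P 2 m2 "\<lambda>l. In 0 l" "\<lambda>j. Out 0 j"]
  unfolding boundary_prog_def writes_simps by auto

lemma boundary_prog_correct:
  assumes inp: "\<And>k l. \<sigma> (In k l) = V k l"
    and zero: "\<And>a far k. \<sigma> (E a far k) = 0"
    and ij: "i \<le> m1" "j \<le> m2" "i = 0 \<or> j = 0"
  shows "fold step (boundary_prog P m1 m2) \<sigma> (Out i j) = integral_approx P m1 m2 V i j"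
proof -
  define e1 where "e1 = edge_prog P 1 m1 (\<lambda>k. In k 0) (\<lambda>i. Out i 0)"
  define e2 where "e2 = edge_prog P 2 m2 (\<lambda>l. In 0 l) (\<lambda>j. Out 0 j)"
  note writes_e1 = writes_edge_prog[of P 1 m1 "\<lambda>k. In k 0" "\<lambda>i. Out i 0", folded e1_def]
  note writes_e2 = writes_edge_prog[of P 2 m2 "\<lambda>l. In 0 l" "\<lambda>j. Out 0 j", folded e2_def]
  have In: "In k l \<notin> writes e1" "In k l \<notin> writes e2" for k l
    using writes_e1 writes_e2 by auto
  have E: "E 2 far k \<notin> writes e1" for far k
    using writes_e1 by auto
  have prog: "boundary_prog P m1 m2 = e1 @ e2 @ [Set (Out 0 0) Mul (Const (lam P)) (Reg (In 0 0))]"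
    by (simp add: boundary_prog_def e1_def e2_def)
  consider "i = 0" "j = 0" | "i > 0" "j = 0" | "i = 0" "j > 0"
    using ij(3) by blast
  then show ?thesis
  proof cases
    case 1
    then show ?thesis
      by (simp add: prog integral_approx_def fold_step_unwritten In inp)
  next
    case 2
    then have "Out i j \<notin> writes e2"
      using writes_e2 by auto
    moreover have "fold step e1 \<sigma> (Out i j) = edge_approx P 1 m1 (\<lambda>k. V k 0) i"
      unfolding e1_def 2(2)
      by (rule edge_prog_correct) (use 2 ij inp zero in \<open>auto simp: inj_def\<close>)
    ultimately show ?thesis
      using 2 by (simp add: prog integral_approx_def fold_step_unwritten)
  next
    case 3
    have "fold step e2 (fold step e1 \<sigma>) (Out i j) = edge_approx P 2 m2 (\<lambda>l. V 0 l) j"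
      unfolding e2_def 3(1)
      by (rule edge_prog_correct) (use 3 ij inp zero In E in \<open>auto simp: inj_def fold_step_unwritten\<close>)
    then show ?thesis
      using 3 by (simp add: prog integral_approx_def)
  qed
qed

lemma eval_prog_correct: "computes_parts P m1 m2 (eval_prog P m1 m2) J Out"
proof -
  have J_part: "run (eval_prog P m1 m2) V (J \<nu> i j) = J_approx P m1 m2 V \<nu> i j"
    if "i \<in> {1..m1}" "j \<in> {1..m2}" for V \<nu> i j
  proof -
    have eval: "eval_prog P m1 m2 = concat (map (J_prog P m1 m2) [Q1, Q2, Q3, Q4]) @ boundary_prog P m1 m2"
      by (simp add: eval_prog_def)
    have "fold step (concat (map (J_prog P m1 m2) [Q1, Q2, Q3, Q4])) (init_store V) (J \<nu> i j)
          = J_approx P m1 m2 V \<nu> i j"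
    proof (rule fold_step_block[where x = \<nu> and S = "{In k l |k l. True} \<union> {D \<nu> k l |k l. True}"])
      show "\<nu> \<in> set [Q1, Q2, Q3, Q4]"
        by (cases \<nu>) auto
      show "fold step (J_prog P m1 m2 \<nu>) \<tau> (J \<nu> i j) = J_approx P m1 m2 V \<nu> i j"
        if "\<And>s. s \<in> {In k l |k l. True} \<union> {D \<nu> k l |k l. True} \<Longrightarrow> \<tau> s = init_store V s" for \<tau>
        by (rule J_prog_correct) (use that \<open>i \<in> {1..m1}\<close> \<open>j \<in> {1..m2}\<close> in auto)
      show "writes (J_prog P m1 m2 \<mu>) \<inter> insert (J \<nu> i j) ({In k l |k l. True} \<union> {D \<nu> k l |k l. True}) = {}"
        if "\<mu> \<noteq> \<nu>" for \<mu>
        using writes_J_prog[of P m1 m2 \<mu>] that by auto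
    qed simp
    moreover have "J \<nu> i j \<notin> writes (boundary_prog P m1 m2)"
      using writes_boundary_prog by auto
    ultimately show ?thesis
      by (simp add: run_def eval fold_step_unwritten)
  qed
  have boundary: "run (eval_prog P m1 m2) V (Out i j) = integral_approx P m1 m2 V i j"
    if "i \<le> m1" "j \<le> m2" "i = 0 \<or> j = 0" for V i j
  proof -
    define js where "js = J_prog P m1 m2 Q1 @ J_prog P m1 m2 Q2 @ J_prog P m1 m2 Q3 @ J_prog P m1 m2 Q4"
    have "In k l \<notin> writes js" "E a far k \<notin> writes js" for k l a far
      using writes_J_prog[of P m1 m2 Q1] writes_J_prog[of P m1 m2 Q2]
        writes_J_prog[of P m1 m2 Q3] writes_J_prog[of P m1 m2 Q4]
      by (auto simp: js_def)
    moreover have "eval_prog P m1 m2 = js @ boundary_prog P m1 m2"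
      by (simp add: eval_prog_def js_def)
    ultimately show ?thesis
      using that by (simp add: run_def boundary_prog_correct fold_step_unwritten)
  qed
  show ?thesis
    unfolding computes_parts_def using J_part boundary by blast
qed

lemma assemble_prog_as_blocks:
  "assemble_prog m1 m2 = concat (map (\<lambda>(i, j).
     [Set (Tmp 0) Add (Reg (J Q1 i j)) (Reg (J Q2 i j)),
      Set (Tmp 0) Add (Reg (Tmp 0)) (Reg (J Q3 i j)),
      Set (Out i j) Add (Reg (Tmp 0)) (Reg (J Q4 i j))])
     (List.product [1..<Suc m1] [1..<Suc m2]))"
  by (simp add: assemble_prog_def concat_map_product del: upt_Suc)

lemma full_prog_correct: "computes_integral P m1 m2 (full_prog P m1 m2) Out"
  unfolding computes_integral_def
proof (intro allI impI)
  fix V i j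
  assume ij: "i \<le> m1" "j \<le> m2"
  define \<sigma> where "\<sigma> = run (eval_prog P m1 m2) V"
  have run: "run (full_prog P m1 m2) V = fold step (assemble_prog m1 m2) \<sigma>"
    by (simp add: run_def full_prog_def \<sigma>_def)
  have parts: "\<sigma> (J \<nu> i j) = J_approx P m1 m2 V \<nu> i j" if "i \<in> {1..m1}" "j \<in> {1..m2}" for \<nu>
    using eval_prog_correct[of P m1 m2] that unfolding computes_parts_def \<sigma>_def by blast
  have axes: "\<sigma> (Out i j) = integral_approx P m1 m2 V i j" if "i = 0 \<or> j = 0"
    using eval_prog_correct[of P m1 m2] that ij unfolding computes_parts_def \<sigma>_def by blast
  show "run (full_prog P m1 m2) V (Out i j) = integral_approx P m1 m2 V i j"
  proof (cases "i = 0 \<or> j = 0")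
    case True
    then have "Out i j \<notin> writes (assemble_prog m1 m2)"
      by (auto simp: assemble_prog_as_blocks simp del: upt_Suc)
    then show ?thesis
      using True axes unfolding run by (simp add: fold_step_unwritten)
  next
    case False
    then have "fold step (assemble_prog m1 m2) \<sigma> (Out i j)
      = \<sigma> (J Q1 i j) + \<sigma> (J Q2 i j) + \<sigma> (J Q3 i j) + \<sigma> (J Q4 i j)"
      unfolding assemble_prog_as_blocks
      by (intro fold_step_block[where x = "(i, j)" and S = "range (\<lambda>\<nu>. J \<nu> i j)"])
         (use ij in \<open>auto simp: distinct_product simp del: upt_Suc\<close>)
    then show ?thesis
      using False ij parts unfolding run by (simp add: integral_approx_def)
  qed
qed


section \<open>Operation counts\<close>

lemma count_ops_simps [simp]:
  "count_ops f [] = 0"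
  "count_ops f (c # cs) = (if operation c = f then 1 else 0) + count_ops f cs"
  "count_ops f (cs @ ds) = count_ops f cs + count_ops f ds"
  "count_ops f (concat css) = sum_list (map (count_ops f) css)"
  by (auto simp: count_ops_def[abs_def] filter_concat length_concat comp_def)

lemma count_ops_map: "(\<And>x. operation (h x) = g) \<Longrightarrow> count_ops f (map h xs) = (if f = g then length xs else 0)"
  by (induction xs) auto

lemma num_ops_simps [simp]:
  "num_ops [] = 0"
  "num_ops (c # cs) = Suc (num_ops cs)"
  "num_ops (cs @ ds) = num_ops cs + num_ops ds"
  "num_ops (concat css) = sum_list (map num_ops css)"
  "num_ops (map h xs) = length xs"
  by (auto simp: num_ops_def[abs_def] length_concat comp_def)

lemma length_consecutive [simp]: "length (consecutive ks) = length ks - 1"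
  by (simp add: consecutive_def)

lemma ops_G_prog:
  defines "n \<equiv> \<lambda>m1 m2 \<nu>. length (cells (far1 \<nu>) m1) * length (cells (far2 \<nu>) m2)"
  shows "count_ops Add (G_prog P m1 m2 \<nu>) = 3 * n m1 m2 \<nu>"
    and "count_ops Mul (G_prog P m1 m2 \<nu>) = 4 * n m1 m2 \<nu>"
    and "num_ops (G_prog P m1 m2 \<nu>) = 7 * n m1 m2 \<nu>"
  by (simp_all add: G_prog_def cell_prog_def n_def comp_def sum_list_triv)

lemma ops_cumsum_prog:
  defines "n1 \<equiv> \<lambda>m1 \<nu>. length (cells (far1 \<nu>) m1)" and "n2 \<equiv> \<lambda>m2 \<nu>. length (cells (far2 \<nu>) m2)"
  shows "count_ops Add (cumsum_prog m1 m2 \<nu>) = n1 m1 \<nu> * (n2 m2 \<nu> - 1) + (n1 m1 \<nu> - 1) * n2 m2 \<nu>"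
    and "num_ops (cumsum_prog m1 m2 \<nu>) = n1 m1 \<nu> * (n2 m2 \<nu> - 1) + (n1 m1 \<nu> - 1) * n2 m2 \<nu>"
  by (simp_all add: cumsum_prog_def n1_def n2_def comp_def sum_list_triv case_prod_unfold
        count_ops_map[where g = Add])

lemma ops_scale_prog:
  "count_ops Mul (scale_prog P m1 m2 \<nu>) = m1 * m2"
  "num_ops (scale_prog P m1 m2 \<nu>) = m1 * m2"
  by (simp_all add: scale_prog_def comp_def sum_list_triv count_ops_map[where g = Mul] del: upt_Suc)

lemma num_ops_edge_prog_le: "num_ops (edge_prog P a m inp out) \<le> 11 * m"
proof -
  have "num_ops (edge_part_prog P a m inp far) \<le> 4 * m" for far
    by (cases far) (simp_all add: edge_part_prog_def comp_def sum_list_triv length_cells)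
  from this[of False] this[of True] show ?thesis
    by (simp add: edge_prog_def comp_def sum_list_triv del: upt_Suc)
qed

lemma num_ops_full_prog: "num_ops (full_prog P m1 m2) = num_ops (eval_prog P m1 m2) + 3 * m1 * m2"
  by (simp add: full_prog_def assemble_prog_def comp_def sum_list_triv del: upt_Suc)

text \<open>
  Compared with asymptotic equivalence, an explicit remainder makes sense for \<open>c = 0\<close> as well, so
  that the work on the axes can be added like every other contribution.
\<close>
definition bilinear_growth :: "real \<Rightarrow> (nat \<Rightarrow> nat \<Rightarrow> nat) \<Rightarrow> bool" where
  "bilinear_growth c N \<longleftrightarrow> (\<exists>C. \<forall>m1\<ge>1. \<forall>m2\<ge>1.
     \<bar>real (N m1 m2) - c * (real m1 * real m2)\<bar> \<le> C * (real m1 + real m2))"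

lemma bilinear_growth_add:
  assumes "bilinear_growth c N" "bilinear_growth d M"
  shows "bilinear_growth (c + d) (\<lambda>m1 m2. N m1 m2 + M m1 m2)"
proof -
  obtain C D where
    C: "\<And>m1 m2. m1 \<ge> 1 \<Longrightarrow> m2 \<ge> 1 \<Longrightarrow> \<bar>real (N m1 m2) - c * (real m1 * real m2)\<bar> \<le> C * (real m1 + real m2)" and
    D: "\<And>m1 m2. m1 \<ge> 1 \<Longrightarrow> m2 \<ge> 1 \<Longrightarrow> \<bar>real (M m1 m2) - d * (real m1 * real m2)\<bar> \<le> D * (real m1 + real m2)"
    using assms unfolding bilinear_growth_def by blast
  have "\<bar>real (N m1 m2 + M m1 m2) - (c + d) * (real m1 * real m2)\<bar> \<le> (C + D) * (real m1 + real m2)"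
    if "m1 \<ge> 1" "m2 \<ge> 1" for m1 m2
    using C[OF that] D[OF that] by (simp add: distrib_right)
  then show ?thesis
    unfolding bilinear_growth_def by blast
qed

lemma bilinear_growth_mult:
  assumes "bilinear_growth c N"
  shows "bilinear_growth (real a * c) (\<lambda>m1 m2. a * N m1 m2)"
proof (induction a)
  case 0
  then show ?case by (auto simp: bilinear_growth_def intro!: exI[of _ 0])
next
  case (Suc a)
  then show ?case
    using bilinear_growth_add[OF assms Suc] by (simp add: algebra_simps)
qed

text \<open>
  The truncated differences cover directions from which some cells are missing: a strip of bounded
  width along the boundary of the table is of the order of the remainder.
\<close>
lemma bilinear_growth_product: "bilinear_growth 1 (\<lambda>m1 m2. (m1 - a) * (m2 - b))"
proof -
  have "\<bar>real ((m1 - a) * (m2 - b)) - 1 * (real m1 * real m2)\<bar> \<le> (real a + real b) * (real m1 + real m2)"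
    for m1 m2 :: nat
  proof -
    define x where "x = real (m1 - a)"
    define y where "y = real (m2 - b)"
    have x: "0 \<le> x" "real m1 - real a \<le> x" "x \<le> real m1" and y: "0 \<le> y" "real m2 - real b \<le> y" "y \<le> real m2"
      by (auto simp: x_def y_def)
    have "x * y \<le> real m1 * real m2"
      using x y by (intro mult_mono) auto
    moreover have "real m1 * real m2 - x * y = real m1 * (real m2 - y) + (real m1 - x) * y"
      by (simp add: algebra_simps)
    moreover have "real m1 * (real m2 - y) \<le> real m1 * real b" "(real m1 - x) * y \<le> real a * real m2"
      using x y by (auto intro!: mult_mono)
    moreover have "real m1 * real b + real a * real m2 \<le> (real a + real b) * (real m1 + real m2)"
      by (simp add: algebra_simps)
    ultimately show ?thesis
      unfolding of_nat_mult x_def[symmetric] y_def[symmetric] by linarith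
  qed
  then show ?thesis
    unfolding bilinear_growth_def by blast
qed

lemma bilinear_growth_linear:
  assumes "\<And>m1 m2. m1 \<ge> 1 \<Longrightarrow> m2 \<ge> 1 \<Longrightarrow> N m1 m2 \<le> C * (m1 + m2)"
  shows "bilinear_growth 0 N"
proof -
  have "real (N m1 m2) \<le> real C * (real m1 + real m2)" if "m1 \<ge> 1" "m2 \<ge> 1" for m1 m2
    using of_nat_mono[OF assms[OF that], where 'a = real] by simp
  then show ?thesis
    unfolding bilinear_growth_def by (auto intro!: exI[of _ "real C"])
qed

text \<open>
  If both \<open>m1\<close> and \<open>m2\<close> are at least \<open>K\<close>, then \<open>m1 + m2 \<le> 2 / K * (m1 * m2)\<close>. It is essential here
  that both numbers of cells become large.
\<close>
lemma leading_bilinear_growth: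
  assumes "bilinear_growth c N" "bilinear_growth c M" "c > 0"
  shows "leading N M"
proof -
  have "bilinear_growth c N \<Longrightarrow> asymp_equiv (\<lambda>(m1, m2). real (N m1 m2)) (sequentially \<times>\<^sub>F sequentially)
      (\<lambda>(m1, m2). c * (real m1 * real m2))" for N
  proof -
    assume "bilinear_growth c N"
    then obtain C where C: "\<And>m1 m2. m1 \<ge> 1 \<Longrightarrow> m2 \<ge> 1 \<Longrightarrow>
        \<bar>real (N m1 m2) - c * (real m1 * real m2)\<bar> \<le> C * (real m1 + real m2)"
      unfolding bilinear_growth_def by blast
    have "(\<lambda>x. (case x of (m1, m2) \<Rightarrow> real (N m1 m2)) - (case x of (m1, m2) \<Rightarrow> c * (real m1 * real m2)))
        \<in> o[sequentially \<times>\<^sub>F sequentially](\<lambda>(m1, m2). c * (real m1 * real m2))"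
    proof (rule landau_o.smallI)
      fix e :: real assume "e > 0"
      then have ec: "e * c > 0" using \<open>c > 0\<close> by simp
      obtain K :: nat where K: "2 * \<bar>C\<bar> / (e * c) < real K"
        using reals_Archimedean2 by blast
      show "\<forall>\<^sub>F x in sequentially \<times>\<^sub>F sequentially.
          norm ((case x of (m1, m2) \<Rightarrow> real (N m1 m2)) - (case x of (m1, m2) \<Rightarrow> c * (real m1 * real m2)))
          \<le> e * norm (case x of (m1, m2) \<Rightarrow> c * (real m1 * real m2))"
        unfolding eventually_prod_sequentially
      proof (intro exI[of _ "K + 1"] allI impI)
        fix m2 m1 assume m: "K + 1 \<le> m2" "K + 1 \<le> m1"
        have "2 * \<bar>C\<bar> \<le> e * c * real K"
          using K ec by (simp add: field_simps)
        then have "2 * \<bar>C\<bar> \<le> e * c * real m1" "2 * \<bar>C\<bar> \<le> e * c * real m2"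
          using m ec by (smt (verit) mult_left_mono of_nat_mono add_leD1)+
        then have "2 * \<bar>C\<bar> * real m2 \<le> e * c * real m1 * real m2" "2 * \<bar>C\<bar> * real m1 \<le> e * c * real m2 * real m1"
          by (auto intro: mult_right_mono)
        moreover have "C * (real m1 + real m2) \<le> \<bar>C\<bar> * real m1 + \<bar>C\<bar> * real m2"
          unfolding distrib_left[symmetric] by (intro mult_right_mono) auto
        ultimately have "C * (real m1 + real m2) \<le> e * (c * (real m1 * real m2))"
          by (simp add: mult_ac)
        with C[of m1 m2] m \<open>c > 0\<close> show "norm ((case (m1, m2) of (m1, m2) \<Rightarrow> real (N m1 m2))
            - (case (m1, m2) of (m1, m2) \<Rightarrow> c * (real m1 * real m2)))
          \<le> e * norm (case (m1, m2) of (m1, m2) \<Rightarrow> c * (real m1 * real m2))"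
          by simp
      qed
    qed
    then show ?thesis
      by (rule smallo_imp_asymp_equiv)
  qed
  from this[OF assms(1)] this[OF assms(2)] show ?thesis
    unfolding leading_def by (rule asymp_equiv_trans[OF _ asymp_equiv_symI])
qed

lemma bilinear_growth_cells:
  "bilinear_growth 1 (\<lambda>m1 m2. (length (cells far m1) - a) * (length (cells far' m2) - b))"
proof -
  have "length (cells far m) - a = m - (of_bool far + a)" for far m a
    by (simp add: length_cells)
  then show ?thesis
    by (simp add: bilinear_growth_product)
qed

lemma bilinear_growth_G_prog:
  "bilinear_growth 3 (\<lambda>m1 m2. count_ops Add (G_prog P m1 m2 \<nu>))"
  "bilinear_growth 4 (\<lambda>m1 m2. count_ops Mul (G_prog P m1 m2 \<nu>))"
  "bilinear_growth 7 (\<lambda>m1 m2. num_ops (G_prog P m1 m2 \<nu>))"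
  using bilinear_growth_mult[OF bilinear_growth_cells[of "far1 \<nu>" 0 "far2 \<nu>" 0], of 3]
    bilinear_growth_mult[OF bilinear_growth_cells[of "far1 \<nu>" 0 "far2 \<nu>" 0], of 4]
    bilinear_growth_mult[OF bilinear_growth_cells[of "far1 \<nu>" 0 "far2 \<nu>" 0], of 7]
  by (simp_all add: ops_G_prog)

lemma bilinear_growth_cumsum_prog:
  "bilinear_growth 2 (\<lambda>m1 m2. count_ops Add (cumsum_prog m1 m2 \<nu>))"
  "bilinear_growth 2 (\<lambda>m1 m2. num_ops (cumsum_prog m1 m2 \<nu>))"
  using bilinear_growth_add[OF bilinear_growth_cells[of "far1 \<nu>" 0 "far2 \<nu>" 1]
      bilinear_growth_cells[of "far1 \<nu>" 1 "far2 \<nu>" 0]]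
  by (simp_all add: ops_cumsum_prog)

lemma bilinear_growth_scale_prog:
  "bilinear_growth 1 (\<lambda>m1 m2. count_ops Mul (scale_prog P m1 m2 \<nu>))"
  "bilinear_growth 1 (\<lambda>m1 m2. num_ops (scale_prog P m1 m2 \<nu>))"
  using bilinear_growth_product[of 0 0] by (simp_all add: ops_scale_prog)

lemma bilinear_growth_J_prog: "bilinear_growth 10 (\<lambda>m1 m2. num_ops (J_prog P m1 m2 \<nu>))"
  using bilinear_growth_add[OF bilinear_growth_G_prog(3)
      bilinear_growth_add[OF bilinear_growth_cumsum_prog(2) bilinear_growth_scale_prog(2)]]
  by (simp add: J_prog_def)

lemma bilinear_growth_eval_prog: "bilinear_growth 40 (\<lambda>m1 m2. num_ops (eval_prog P m1 m2))"
proof -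
  have boundary: "bilinear_growth 0 (\<lambda>m1 m2. num_ops (boundary_prog P m1 m2))"
  proof (rule bilinear_growth_linear[of _ 12])
    fix m1 m2 :: nat assume "m1 \<ge> 1"
    then show "num_ops (boundary_prog P m1 m2) \<le> 12 * (m1 + m2)"
      using num_ops_edge_prog_le[of P 1 m1 "\<lambda>k. In k 0" "\<lambda>i. Out i 0"]
        num_ops_edge_prog_le[of P 2 m2 "\<lambda>l. In 0 l" "\<lambda>j. Out 0 j"]
      by (simp add: boundary_prog_def)
  qed
  note j = bilinear_growth_J_prog[of P]
  from bilinear_growth_add[OF j[of Q1] bilinear_growth_add[OF j[of Q2]
      bilinear_growth_add[OF j[of Q3] bilinear_growth_add[OF j[of Q4] boundary]]]]
  show ?thesis
    by (simp add: eval_prog_def)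
qed

lemma bilinear_growth_full_prog: "bilinear_growth 43 (\<lambda>m1 m2. num_ops (full_prog P m1 m2))"
  using bilinear_growth_add[OF bilinear_growth_eval_prog[of P]
      bilinear_growth_mult[OF bilinear_growth_product[of 0 0], of 3]]
  by (simp add: num_ops_full_prog mult_ac)

lemma bilinear_growth_monomial: "bilinear_growth (real a) (\<lambda>m1 m2. a * m1 * m2)"
  using bilinear_growth_mult[OF bilinear_growth_product[of 0 0], of a] by (simp add: mult_ac)

lemma bilinear_growth_grid_points: "bilinear_growth (real a) (\<lambda>m1 m2. a * grid_points m1 m2)"
proof -
  have "bilinear_growth 0 (\<lambda>m1 m2. m1 + m2 + 1)"
    by (rule bilinear_growth_linear[of _ 2]) simp
  from bilinear_growth_mult[OF bilinear_growth_add[OF bilinear_growth_product[of 0 0] this], of a]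
  show ?thesis
    by (simp add: grid_points_def algebra_simps)
qed



section \<open>Dependence of the corner value on every grid value\<close>

lemma xi_int_eq: "strike P > 0 \<Longrightarrow> xi_int P = 20"
  by (simp add: xi_int_def mesh_d_def)

lemma xi_max_pos:
  assumes "strike P > 0" "Smax P > 2 * strike P"
  shows "xi_max P > 0"
proof -
  have "0 < Smax P / mesh_d P - 20"
    using assms by (simp add: mesh_d_def field_simps)
  then have "0 < sinh (arsinh (Smax P / mesh_d P - 20))"
    by simp
  then have "0 < arsinh (Smax P / mesh_d P - 20)"
    by (simp only: sinh_real_pos_iff)
  then show ?thesis
    unfolding xi_max_def xi_int_eq[OF assms(1)] by linarith
qed

lemma phi_strict_mono:
  assumes "strike P > 0"
  shows "strict_mono (phi P)"
proof (rule strict_monoI)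
  fix x y :: real assume "x < y"
  then show "phi P x < phi P y"
  proof (cases "x \<le> 20 \<and> 20 < y")
    case True
    then have "phi P x \<le> mesh_d P * 20"
      using assms by (auto simp: phi_def xi_int_eq mesh_d_def)
    also have "\<dots> = 2 * strike P"
      by (simp add: mesh_d_def)
    also have "\<dots> < phi P y"
      using True assms by (auto simp: phi_def xi_int_eq mesh_d_def)
    finally show ?thesis .
  qed (use assms in \<open>auto simp: phi_def xi_int_eq mesh_d_def\<close>)
qed

text \<open>
  These are the integrals of \<open>(b - x) * x powr (e - 1)\<close> and \<open>(x - a) * x powr (e - 1)\<close> over the
  interval from \<open>a\<close> to \<open>b\<close>, that is, up to the factor \<open>1 / (b - a)\<close>, the integrals of the two
  linear shape functions of a cell against the weight \<open>x powr (e - 1)\<close>.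
\<close>
lemma hat_moments_pos:
  fixes a b e :: real
  assumes "0 \<le> a" "a < b" "e > 0"
  shows "b * ((b powr e - a powr e) / e) - (b powr (1 + e) - a powr (1 + e)) / (1 + e) > 0"
    and "- a * ((b powr e - a powr e) / e) + (b powr (1 + e) - a powr (1 + e)) / (1 + e) > 0"
proof -
  define F where "F x = x powr e / e" for x
  define H where "H x = x powr (1 + e) / (1 + e)" for x
  have F: "(F has_field_derivative x powr (e - 1)) (at x)"
    and H: "(H has_field_derivative x * x powr (e - 1)) (at x)" if "x > 0" for x
  proof -
    show "(F has_field_derivative x powr (e - 1)) (at x)"
      unfolding F_def using that assms by (auto intro!: derivative_eq_intros)
    have "x powr e = x * x powr (e - 1)"
      using that powr_add[of x 1 "e - 1"] by simp
    then show "(H has_field_derivative x * x powr (e - 1)) (at x)"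
      unfolding H_def using that assms by (auto intro!: derivative_eq_intros)
  qed
  have cont: "continuous_on {a..b} F" "continuous_on {a..b} H"
    using assms unfolding F_def H_def by (auto intro!: continuous_intros continuous_on_powr')
  \<comment> \<open>differentiability is only available inside the interval: if \<open>a = 0\<close> and \<open>e < 1\<close>, then \<open>F\<close> has
    infinite slope at \<open>a\<close>\<close>
  have "b * F a - H a < b * F b - H b"
  proof (rule DERIV_pos_imp_increasing_open[OF assms(2)])
    fix x assume x: "a < x" "x < b"
    have "((\<lambda>x. b * F x - H x) has_field_derivative b * x powr (e - 1) - x * x powr (e - 1)) (at x)"
      using x assms by (intro DERIV_diff DERIV_cmult F H) auto
    moreover have "b * x powr (e - 1) - x * x powr (e - 1) > 0"
      using x assms by simp
    ultimately show "\<exists>y. ((\<lambda>x. b * F x - H x) has_field_derivative y) (at x) \<and> 0 < y"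
      by blast
  qed (intro continuous_intros cont)
  then show "b * ((b powr e - a powr e) / e) - (b powr (1 + e) - a powr (1 + e)) / (1 + e) > 0"
    by (simp add: F_def H_def diff_divide_distrib right_diff_distrib)
  have "H a - a * F a < H b - a * F b"
  proof (rule DERIV_pos_imp_increasing_open[OF assms(2)])
    fix x assume x: "a < x" "x < b"
    have "((\<lambda>x. H x - a * F x) has_field_derivative x * x powr (e - 1) - a * x powr (e - 1)) (at x)"
      using x assms by (intro DERIV_diff DERIV_cmult F H) auto
    moreover have "x * x powr (e - 1) - a * x powr (e - 1) > 0"
      using x assms by simp
    ultimately show "\<exists>y. ((\<lambda>x. H x - a * F x) has_field_derivative y) (at x) \<and> 0 < y"
      by blast
  qed (intro continuous_intros cont)
  then show "- a * ((b powr e - a powr e) / e) + (b powr (1 + e) - a powr (1 + e)) / (1 + e) > 0"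
    by (simp add: F_def H_def diff_divide_distrib right_diff_distrib)
qed

text \<open>
  Both the jump density and bilinear interpolation are products of their one-dimensional
  counterparts, hence so are the weights.
\<close>
lemma gamma_Q1_eq:
  "gamma00 P m1 m2 Q1 k l = edge_gamma0 P 1 m1 False k * edge_gamma0 P 2 m2 False l"
  "gamma10 P m1 m2 Q1 k l = edge_gamma1 P 1 m1 False k * edge_gamma0 P 2 m2 False l"
  "gamma01 P m1 m2 Q1 k l = edge_gamma0 P 1 m1 False k * edge_gamma1 P 2 m2 False l"
  "gamma11 P m1 m2 Q1 k l = edge_gamma1 P 1 m1 False k * edge_gamma1 P 2 m2 False l"
proof -
  have zeta: "zeta P m1 m2 Q1 a b k l = edge_zeta P 1 m1 False a k * edge_zeta P 2 m2 False b l" for a b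
    by (simp add: zeta_def edge_zeta_def edge_exp_def)
  show "gamma00 P m1 m2 Q1 k l = edge_gamma0 P 1 m1 False k * edge_gamma0 P 2 m2 False l"
    unfolding gamma00_def edge_gamma0_def delta_def zeta times_divide_times_eq
    by (rule arg_cong2[where f = "(/)"]) (simp_all add: algebra_simps)
  show "gamma10 P m1 m2 Q1 k l = edge_gamma1 P 1 m1 False k * edge_gamma0 P 2 m2 False l"
    unfolding gamma10_def edge_gamma0_def edge_gamma1_def delta_def zeta times_divide_times_eq
    by (rule arg_cong2[where f = "(/)"]) (simp_all add: algebra_simps)
  show "gamma01 P m1 m2 Q1 k l = edge_gamma0 P 1 m1 False k * edge_gamma1 P 2 m2 False l"
    unfolding gamma01_def edge_gamma0_def edge_gamma1_def delta_def zeta times_divide_times_eq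
    by (rule arg_cong2[where f = "(/)"]) (simp_all add: algebra_simps)
  show "gamma11 P m1 m2 Q1 k l = edge_gamma1 P 1 m1 False k * edge_gamma1 P 2 m2 False l"
    unfolding gamma11_def edge_gamma1_def delta_def zeta times_divide_times_eq
    by (rule arg_cong2[where f = "(/)"]) (simp_all add: algebra_simps)
qed

definition unit_value :: "nat \<Rightarrow> nat \<Rightarrow> nat \<Rightarrow> nat \<Rightarrow> real" where
  "unit_value k l i j = of_bool (i = k \<and> j = l)"

lemma J_approx_zero: "J_approx P m1 m2 (\<lambda>_ _. 0) \<nu> i j = 0"
  by (simp add: J_approx_def G_def)

text \<open>
  At the far corner the sums of the other three quadrants are empty.
\<close>
lemma integral_approx_corner:
  "m1 \<ge> 1 \<Longrightarrow> m2 \<ge> 1 \<Longrightarrow> integral_approx P m1 m2 V m1 m2 = J_approx P m1 m2 V Q1 m1 m2"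
  by (simp add: integral_approx_def J_approx_def cell_range_def)

lemma mesh_less:
  assumes grid: "strike P > 0" "Smax P > 2 * strike P" and "m \<ge> 1" "i < j"
  shows "mesh P m i < mesh P m j"
  using assms xi_max_pos[OF grid] strict_monoD[OF phi_strict_mono[OF grid(1)]]
  by (simp add: mesh_def divide_strict_right_mono)

lemma mesh_nonneg:
  assumes grid: "strike P > 0" "Smax P > 2 * strike P" and "m \<ge> 1"
  shows "mesh P m i \<ge> 0"
  using mesh_less[OF assms, of 0 i] grid(1) by (cases "i = 0") (auto simp: mesh_def phi_def xi_int_eq)

lemma edge_gamma_pos:
  assumes grid: "strike P > 0" "Smax P > 2 * strike P"
    and eta: "eta_q P a > 0" and "m \<ge> 1" "k \<ge> 1"
  shows "edge_gamma0 P a m False k > 0" "edge_gamma1 P a m False k > 0"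
proof -
  have "0 \<le> mesh P m (k - 1)" "mesh P m (k - 1) < mesh P m k" "eta_q P a > 0"
    using assms mesh_nonneg[OF grid] mesh_less[OF grid] by auto
  from hat_moments_pos[OF this] this(2)
  show "edge_gamma0 P a m False k > 0" "edge_gamma1 P a m False k > 0"
    by (simp_all add: edge_gamma0_def edge_gamma1_def edge_zeta_def edge_exp_def)
qed

text \<open>
  Every grid point is a vertex of some cell, every cell enters the sum at the corner \<open>(m1, m2)\<close>, and
  all weights are positive, so nothing can cancel.
\<close>
lemma J_approx_unit_pos:
  assumes par: "lam P > 0" "\<And>a. a \<in> {1, 2} \<Longrightarrow> q P a > 0 \<and> eta_q P a > 0"
    and grid: "strike P > 0" "Smax P > 2 * strike P"
    and m: "m1 \<ge> 1" "m2 \<ge> 1" and kl: "k \<le> m1" "l \<le> m2"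
  shows "J_approx P m1 m2 (unit_value k l) Q1 m1 m2 > 0"
proof -
  let ?V = "unit_value k l"
  \<comment> \<open>\<open>(k', l')\<close> is a cell with the grid point \<open>(k, l)\<close> as a vertex; the points on the axes have no
    cell below them\<close>
  define k' where "k' = max 1 k"
  define l' where "l' = max 1 l"
  have kl': "k' \<in> {1..m1}" "l' \<in> {1..m2}"
    using m kl by (auto simp: k'_def l'_def)
  have gamma: "gamma00 P m1 m2 Q1 i j > 0" "gamma10 P m1 m2 Q1 i j > 0"
      "gamma01 P m1 m2 Q1 i j > 0" "gamma11 P m1 m2 Q1 i j > 0" if "i \<ge> 1" "j \<ge> 1" for i j
    unfolding gamma_Q1_eq using that m par(2) edge_gamma_pos[OF grid] by simp_all
  have G_nonneg: "G P m1 m2 ?V Q1 i j \<ge> 0" if "i \<ge> 1" "j \<ge> 1" for i j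
    using gamma[OF that] by (simp add: G_def unit_value_def)
  have G_pos: "G P m1 m2 ?V Q1 k' l' > 0"
    using gamma[of k' l'] by (cases "k = 0"; cases "l = 0") (auto simp: G_def unit_value_def k'_def l'_def max_def)
  have "(\<Sum>i\<in>{1..m1}. \<Sum>j\<in>{1..m2}. G P m1 m2 ?V Q1 i j) > 0"
  proof (rule sum_pos2[where i = k'])
    show "(\<Sum>j\<in>{1..m2}. G P m1 m2 ?V Q1 k' j) > 0"
      by (rule sum_pos2[where i = l']) (use kl' G_pos G_nonneg in auto)
  qed (use kl' G_nonneg in \<open>auto intro!: sum_nonneg\<close>)
  moreover have "psi P Q1 (mesh P m1 m1) (mesh P m2 m2) > 0"
    using par(1) par(2)[of 1] par(2)[of 2] mesh_less[OF grid m(1), of 0 m1] mesh_less[OF grid m(2), of 0 m2]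
      mesh_nonneg[OF grid m(1), of 0] mesh_nonneg[OF grid m(2), of 0] m
    by simp
  ultimately show ?thesis
    by (simp add: J_approx_def cell_range_def)
qed

section \<open>A lower bound for all programs\<close>

fun operand_regs :: "operand \<Rightarrow> reg set" where
  "operand_regs (Const c) = {}"
| "operand_regs (Reg r) = {r}"

fun instr_reads :: "instr \<Rightarrow> reg set" where
  "instr_reads (Set r f x y) = operand_regs x \<union> operand_regs y"

definition reads :: "program \<Rightarrow> reg set" where
  "reads prog = (\<Union>c\<in>set prog. instr_reads c)"

lemma finite_instr_reads: "finite (instr_reads c) \<and> card (instr_reads c) \<le> 2"
proof (cases c)
  case (Set r f x y)
  then show ?thesis
    by (cases x; cases y) (auto simp: card_insert_if)
qed

lemma finite_reads: "finite (reads prog)"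
  by (simp add: reads_def finite_instr_reads)

lemma card_reads_le: "card (reads prog) \<le> 2 * num_ops prog"
proof (induction prog)
  case (Cons c prog)
  have "card (reads (c # prog)) \<le> card (instr_reads c) + card (reads prog)"
    by (simp add: reads_def card_Un_le)
  also have "\<dots> \<le> 2 * num_ops (c # prog)"
    using Cons finite_instr_reads[of c] by (simp add: num_ops_def)
  finally show ?case .
qed (simp add: reads_def)

lemma fold_step_cong_unread:
  assumes "r \<notin> reads prog" "\<And>s. s \<noteq> r \<Longrightarrow> \<sigma> s = \<tau> s" "s \<noteq> r"
  shows "fold step prog \<sigma> s = fold step prog \<tau> s"
  using assms
proof (induction prog arbitrary: \<sigma> \<tau>)
  case (Cons c prog)
  have "step c \<sigma> s = step c \<tau> s" if "s \<noteq> r" for s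
  proof (cases c)
    case (Set t f x y)
    have "fetch \<sigma> z = fetch \<tau> z" if "z = x \<or> z = y" for z
      using that Cons.prems(1,2) Set by (cases z) (auto simp: reads_def)
    then show ?thesis
      using Set that Cons.prems(2) by simp
  qed
  then show ?case
    using Cons.IH[of "step c \<sigma>" "step c \<tau>"] Cons.prems by (simp add: reads_def)
qed simp

text \<open>
  Changing an input that is never read changes no register but its own. The exception matters for
  the register \<open>r\<close> of the result, which may be an input register: this is the summand \<open>1\<close>.
\<close>
lemma num_ops_lower_bound:
  assumes sensitive: "\<And>k l. k \<le> m1 \<Longrightarrow> l \<le> m2 \<Longrightarrow> run prog (unit_value k l) r \<noteq> run prog (\<lambda>_ _. 0) r"
  shows "grid_points m1 m2 \<le> 2 * num_ops prog + 1"
proof -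
  define inputs where "inputs = (\<lambda>(k, l). In k l) ` ({..m1} \<times> {..m2})"
  have "inputs - {r} \<subseteq> reads prog"
  proof
    fix s assume "s \<in> inputs - {r}"
    then obtain k l where kl: "s = In k l" "k \<le> m1" "l \<le> m2" "r \<noteq> In k l"
      by (auto simp: inputs_def)
    have agree: "init_store (unit_value k l) s = init_store (\<lambda>_ _. 0) s" if "s \<noteq> In k l" for s
      using that by (cases s) (auto simp: unit_value_def)
    show "s \<in> reads prog"
    proof (rule ccontr)
      assume "s \<notin> reads prog"
      then have "run prog (unit_value k l) r = run prog (\<lambda>_ _. 0) r"
        unfolding run_def using agree kl by (intro fold_step_cong_unread[of "In k l"]) auto
      with sensitive kl show False
        by blast
    qed
  qed
  then have "card (inputs - {r}) \<le> 2 * num_ops prog"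
    using card_mono[OF finite_reads] card_reads_le order_trans by blast
  moreover have "card inputs - 1 \<le> card (inputs - {r})"
    using card_Diff_singleton_if[of inputs r] by (simp split: if_splits)
  moreover have "card inputs = grid_points m1 m2"
    unfolding inputs_def by (subst card_image) (auto simp: inj_on_def grid_points_def)
  ultimately show ?thesis
    by linarith
qed


section \<open>The cost of the double integral\<close>

theorem mainTheorem3:
  fixes P :: kou
  assumes lam: "lam P > 0"
    and par: "\<And>a. a \<in> {1, 2} \<Longrightarrow> p P a > 0 \<and> q P a > 0 \<and> p P a + q P a = 1
                     \<and> eta_p P a > 1 \<and> eta_q P a > 0"
    and strike: "strike P > 0"
    and Smax: "Smax P > 2 * strike P"
  shows
    \<comment> \<open>the programs compute the approximation on the full grid, for every vector of values\<close>
    "(\<forall>m1\<ge>1. \<forall>m2\<ge>1. computes_parts P m1 m2 (eval_prog P m1 m2) J Out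
        \<and> computes_integral P m1 m2 (full_prog P m1 m2) Out)
    \<comment> \<open>operation counts for the first integral\<close>
     \<and> (\<forall>m1\<ge>1. \<forall>m2\<ge>1.
          count_ops Add (G_prog P m1 m2 Q1) = 3 * m1 * m2
        \<and> count_ops Mul (G_prog P m1 m2 Q1) = 4 * m1 * m2
        \<and> num_ops (G_prog P m1 m2 Q1) = 7 * m1 * m2
        \<and> num_ops (cumsum_prog m1 m2 Q1) = count_ops Add (cumsum_prog m1 m2 Q1)
        \<and> num_ops (scale_prog P m1 m2 Q1) = m1 * m2
        \<and> count_ops Mul (scale_prog P m1 m2 Q1) = m1 * m2)
     \<and> leading (\<lambda>m1 m2. num_ops (cumsum_prog m1 m2 Q1)) (\<lambda>m1 m2. 2 * m1 * m2)
    \<comment> \<open>all four integrals, stage by stage and in total\<close>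
     \<and> (\<forall>\<nu>. leading (\<lambda>m1 m2. count_ops Add (G_prog P m1 m2 \<nu>)) (\<lambda>m1 m2. 3 * m1 * m2)
          \<and> leading (\<lambda>m1 m2. count_ops Mul (G_prog P m1 m2 \<nu>)) (\<lambda>m1 m2. 4 * m1 * m2)
          \<and> leading (\<lambda>m1 m2. count_ops Add (cumsum_prog m1 m2 \<nu>)) (\<lambda>m1 m2. 2 * m1 * m2)
          \<and> leading (\<lambda>m1 m2. count_ops Mul (scale_prog P m1 m2 \<nu>)) (\<lambda>m1 m2. m1 * m2)
          \<and> leading (\<lambda>m1 m2. num_ops (J_prog P m1 m2 \<nu>)) (\<lambda>m1 m2. 10 * m1 * m2))
     \<and> leading (\<lambda>m1 m2. num_ops (eval_prog P m1 m2)) (\<lambda>m1 m2. 40 * m1 * m2)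
    \<comment> \<open>adding up the four contributions at the points off the axes\<close>
     \<and> (\<forall>m1 m2. num_ops (full_prog P m1 m2) = num_ops (eval_prog P m1 m2) + 3 * m1 * m2)
    \<comment> \<open>cost proportional to the number of grid points\<close>
     \<and> leading (\<lambda>m1 m2. num_ops (eval_prog P m1 m2)) (\<lambda>m1 m2. 40 * grid_points m1 m2)
     \<and> leading (\<lambda>m1 m2. num_ops (full_prog P m1 m2)) (\<lambda>m1 m2. 43 * grid_points m1 m2)
    \<comment> \<open>no program has a cost of smaller order\<close>
     \<and> (\<exists>c>0. \<forall>m1\<ge>1. \<forall>m2\<ge>1. \<forall>prog.
          (\<exists>part out. computes_parts P m1 m2 prog part out)
          \<or> (\<exists>out. computes_integral P m1 m2 prog out)
          \<longrightarrow> c * real (grid_points m1 m2) \<le> real (num_ops prog))"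
proof -
  have q: "q P a > 0 \<and> eta_q P a > 0" if "a \<in> {1, 2}" for a
    using par[OF that] by simp
  have J_counts: "leading (\<lambda>m1 m2. count_ops Add (G_prog P m1 m2 \<nu>)) (\<lambda>m1 m2. 3 * m1 * m2)
          \<and> leading (\<lambda>m1 m2. count_ops Mul (G_prog P m1 m2 \<nu>)) (\<lambda>m1 m2. 4 * m1 * m2)
          \<and> leading (\<lambda>m1 m2. count_ops Add (cumsum_prog m1 m2 \<nu>)) (\<lambda>m1 m2. 2 * m1 * m2)
          \<and> leading (\<lambda>m1 m2. count_ops Mul (scale_prog P m1 m2 \<nu>)) (\<lambda>m1 m2. m1 * m2)
          \<and> leading (\<lambda>m1 m2. num_ops (J_prog P m1 m2 \<nu>)) (\<lambda>m1 m2. 10 * m1 * m2)" for \<nu>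
    using leading_bilinear_growth[OF bilinear_growth_G_prog(1)[of P \<nu>], of "\<lambda>m1 m2. 3 * m1 * m2"]
      leading_bilinear_growth[OF bilinear_growth_G_prog(2)[of P \<nu>], of "\<lambda>m1 m2. 4 * m1 * m2"]
      leading_bilinear_growth[OF bilinear_growth_cumsum_prog(1)[of \<nu>], of "\<lambda>m1 m2. 2 * m1 * m2"]
      leading_bilinear_growth[OF bilinear_growth_scale_prog(1)[of P \<nu>], of "\<lambda>m1 m2. m1 * m2"]
      leading_bilinear_growth[OF bilinear_growth_J_prog[of P \<nu>], of "\<lambda>m1 m2. 10 * m1 * m2"]
      bilinear_growth_monomial[of 3] bilinear_growth_monomial[of 4] bilinear_growth_monomial[of 2]
      bilinear_growth_monomial[of 1] bilinear_growth_monomial[of 10]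
    by simp
  have cumsum: "leading (\<lambda>m1 m2. num_ops (cumsum_prog m1 m2 Q1)) (\<lambda>m1 m2. 2 * m1 * m2)"
    using leading_bilinear_growth[OF bilinear_growth_cumsum_prog(2)[of Q1], of "\<lambda>m1 m2. 2 * m1 * m2"]
      bilinear_growth_monomial[of 2] by simp
  have eval: "leading (\<lambda>m1 m2. num_ops (eval_prog P m1 m2)) (\<lambda>m1 m2. 40 * m1 * m2)"
      "leading (\<lambda>m1 m2. num_ops (eval_prog P m1 m2)) (\<lambda>m1 m2. 40 * grid_points m1 m2)"
    using leading_bilinear_growth[OF bilinear_growth_eval_prog[of P]]
      bilinear_growth_monomial[of 40] bilinear_growth_grid_points[of 40] by simp_all
  have full: "leading (\<lambda>m1 m2. num_ops (full_prog P m1 m2)) (\<lambda>m1 m2. 43 * grid_points m1 m2)"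
    using leading_bilinear_growth[OF bilinear_growth_full_prog[of P]]
      bilinear_growth_grid_points[of 43] by simp
  have lower: "3 / 8 * real (grid_points m1 m2) \<le> real (num_ops prog)"
    if m: "m1 \<ge> 1" "m2 \<ge> 1" and
      computes: "(\<exists>part out. computes_parts P m1 m2 prog part out)
        \<or> (\<exists>out. computes_integral P m1 m2 prog out)" for m1 m2 prog
  proof -
    obtain r where r: "\<And>V. run prog V r = J_approx P m1 m2 V Q1 m1 m2"
    proof -
      from computes consider
          part out where "computes_parts P m1 m2 prog part out"
        | out where "computes_integral P m1 m2 prog out"
        by blast
      then show ?thesis
      proof cases
        case 1
        then show ?thesis
          using m by (intro that[of "part Q1 m1 m2"]) (simp add: computes_parts_def)
      next
        case 2
        then show ?thesis
          using m by (intro that[of "out m1 m2"])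
            (simp add: computes_integral_def integral_approx_corner)
      qed
    qed
    have "grid_points m1 m2 \<le> 2 * num_ops prog + 1"
      using J_approx_unit_pos[OF lam q strike Smax m]
      by (intro num_ops_lower_bound[of m1 m2 prog r]) (simp add: r J_approx_zero less_imp_neq[symmetric])
    moreover have "4 \<le> grid_points m1 m2"
      using mult_le_mono[of 2 "m1 + 1" 2 "m2 + 1"] m by (simp add: grid_points_def)
    \<comment> \<open>for \<open>g\<close> grid points, \<open>g \<ge> 4\<close> gives \<open>(g - 1) / 2 \<ge> 3 / 8 * g\<close>\<close>
    ultimately show ?thesis
      by linarith
  qed
  have optimal: "\<exists>c>0. \<forall>m1\<ge>1. \<forall>m2\<ge>1. \<forall>prog.
      (\<exists>part out. computes_parts P m1 m2 prog part out)
      \<or> (\<exists>out. computes_integral P m1 m2 prog out)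
      \<longrightarrow> c * real (grid_points m1 m2) \<le> real (num_ops prog)"
    by (rule exI[of _ "3 / 8"]) (use lower in auto)
  show ?thesis
  proof (intro conjI)
    show "\<forall>m1\<ge>1. \<forall>m2\<ge>1. computes_parts P m1 m2 (eval_prog P m1 m2) J Out
        \<and> computes_integral P m1 m2 (full_prog P m1 m2) Out"
      using eval_prog_correct full_prog_correct by blast
    show "\<forall>m1\<ge>1. \<forall>m2\<ge>1.
          count_ops Add (G_prog P m1 m2 Q1) = 3 * m1 * m2
        \<and> count_ops Mul (G_prog P m1 m2 Q1) = 4 * m1 * m2
        \<and> num_ops (G_prog P m1 m2 Q1) = 7 * m1 * m2
        \<and> num_ops (cumsum_prog m1 m2 Q1) = count_ops Add (cumsum_prog m1 m2 Q1)
        \<and> num_ops (scale_prog P m1 m2 Q1) = m1 * m2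
        \<and> count_ops Mul (scale_prog P m1 m2 Q1) = m1 * m2"
      by (simp add: ops_G_prog ops_cumsum_prog ops_scale_prog length_cells)
  qed (use J_counts cumsum eval full num_ops_full_prog optimal in blast)+
qed

end
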